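(* Let $n\ge3$ be odd, $\Gamma\subset\mathbb R^n$ a lattice and $\Gamma^*=\{\gamma\in\mathbb R^n:\langle\gamma,\mu\rangle\in\mathbb Z\ \forall\mu\in\Gamma\}$ its dual lattice, and let $M=\mathbb R^n/\Gamma$ be the flat torus with the orientation induced from $\mathbb R^n$. Then a number $\lambda\ne0$ is an eigenvalue of $\operatorname{curl}$ on $M$ if and only if there exists $\mu\in\Gamma^*$ with $|\lambda|=2\pi|\mu|$, and in that case $$m(\operatorname{curl},\lambda)=\frac12\binom{n-1}{\frac{n-1}{2}}\cdot\#\Big\{\mu\in\Gamma^*:|\mu|=\frac{|\lambda|}{2\pi}\Big\}.$$
   Context: For $M$ oriented of odd dimension $n$ with exterior differential $d$ and Hodge star $\ast$, the curl operator on complex-valued $\frac{n-1}{2}$-forms is $\operatorname{curl}=i\ast d$ if $n\equiv1\pmod 4$ and $\operatorname{curl}=\ast d$ if $n\equiv 3\pmod 4$; $m(\operatorname{curl},\lambda)$ is the dimension of its eigenspace for $\lambda$. *)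

theory Defs
  imports "HOL-Analysis.Analysis" "HOL-Library.Function_Algebras"
begin

definition is_lattice :: "(real^'n) set \<Rightarrow> bool" where
  "is_lattice L \<longleftrightarrow> (\<exists>B. independent B \<and> span B = UNIV \<and>
      L = {x. \<exists>c :: real^'n \<Rightarrow> int. x = (\<Sum>b\<in>B. of_int (c b) *\<^sub>R b)})"

definition dual_lattice :: "(real^'n) set \<Rightarrow> (real^'n) set" where
  "dual_lattice L = {g. \<forall>m\<in>L. g \<bullet> m \<in> \<int>}"

text \<open>Functions on the flat torus R^n / L = L-periodic functions on R^n.\<close>

definition periodic_on_lattice :: "(real^'n) set \<Rightarrow> (real^'n \<Rightarrow> complex) \<Rightarrow> bool" where
  "periodic_on_lattice L f \<longleftrightarrow> (\<forall>x. \<forall>g\<in>L. f (x + g) = f x)"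

definition partial :: "'n::finite \<Rightarrow> (real^'n \<Rightarrow> complex) \<Rightarrow> real^'n \<Rightarrow> complex" where
  "partial i f x = vector_derivative (\<lambda>t. f (x + t *\<^sub>R axis i 1)) (at 0)"

fun iter_partial :: "'n::finite list \<Rightarrow> (real^'n \<Rightarrow> complex) \<Rightarrow> real^'n \<Rightarrow> complex" where
  "iter_partial [] f = f"
| "iter_partial (i # is) f = partial i (iter_partial is f)"

definition smooth_fun :: "(real^'n::finite \<Rightarrow> complex) \<Rightarrow> bool" where
  "smooth_fun f \<longleftrightarrow> (\<forall>is. continuous_on UNIV (iter_partial is f) \<and>
      (\<forall>x i. (\<lambda>t. iter_partial is f (x + t *\<^sub>R axis i 1)) differentiable (at 0)))"

text \<open>A complex-valued k-form on the torus, in the standard global coframe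
  dx_i of R^n: the coefficient of dx_J (J a k-subset of the index type, wedge
  taken in increasing order w.r.t. the linear order on 'n) is the function omega J.
  Coefficients at index sets of other cardinality are zero.\<close>

type_synonym 'n form = "'n set \<Rightarrow> real^'n \<Rightarrow> complex"

definition smooth_forms :: "(real^'n::{finite,linorder}) set \<Rightarrow> nat \<Rightarrow> 'n form set" where
  "smooth_forms L k = {w. (\<forall>J. card J \<noteq> k \<longrightarrow> w J = (\<lambda>_. 0)) \<and>
      (\<forall>J. smooth_fun (w J) \<and> periodic_on_lattice L (w J))}"

definition ext_d :: "nat \<Rightarrow> ('n::{finite,linorder}) form \<Rightarrow> 'n form" where
  "ext_d k w J = (if card J = Suc k then
      (\<lambda>x. \<Sum>j\<in>J. (-1) ^ card {i\<in>J. i < j} * partial j (w (J - {j})) x)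
    else (\<lambda>_. 0))"

definition shuffle_sign :: "('n::linorder) set \<Rightarrow> 'n set \<Rightarrow> complex" where
  "shuffle_sign A B = (-1) ^ card {(a, b). a \<in> A \<and> b \<in> B \<and> b < a}"

text \<open>Hodge star of a j-form on flat R^n with the standard orientation:
  star (dx_J) = sign(J, J^c) dx_{J^c}.\<close>

definition hodge :: "nat \<Rightarrow> ('n::{finite,linorder}) form \<Rightarrow> 'n form" where
  "hodge j w K = (if card K = CARD('n) - j then
      (\<lambda>x. shuffle_sign (UNIV - K) K * w (UNIV - K) x) else (\<lambda>_. 0))"

definition curl :: "('n::{finite,linorder}) form \<Rightarrow> 'n form" where
  "curl w = (let n = CARD('n); k = (n - 1) div 2;
               c = (if n mod 4 = 1 then \<i> else 1)
             in (\<lambda>J x. c * hodge (Suc k) (ext_d k w) J x))"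

definition form_scale :: "complex \<Rightarrow> ('n::finite) form \<Rightarrow> 'n form" where
  "form_scale c w = (\<lambda>J x. c * w J x)"

definition curl_eigenspace :: "(real^'n::{finite,linorder}) set \<Rightarrow> complex \<Rightarrow> 'n form set" where
  "curl_eigenspace L lam =
     {w \<in> smooth_forms L ((CARD('n) - 1) div 2). curl w = form_scale lam w}"

definition is_curl_eigenvalue :: "(real^'n::{finite,linorder}) set \<Rightarrow> complex \<Rightarrow> bool" where
  "is_curl_eigenvalue L lam \<longleftrightarrow> (\<exists>w \<in> curl_eigenspace L lam. w \<noteq> 0)"

definition curl_mult :: "(real^'n::{finite,linorder}) set \<Rightarrow> complex \<Rightarrow> nat" where
  "curl_mult L lam = vector_space.dim form_scale (curl_eigenspace L lam)"

end

(* Identify forms on the torus with periodic forms on R^n. Fourier projection onto the character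
exp (2 pi i <m, x>), m in the dual lattice, commutes with all constant-coefficient differential
operators, so every eigenform of curl is a sum of modes v * exp (2 pi i <m, x>), where v is a
constant form with S_m v = lam v for the symbol S_m of curl. The square of S_m on constant forms of
the middle degree is 4 pi^2 (contraction with m) o (exterior product with m), hence lam <> 0 forces
|lam| = 2 pi |m|, and the eigenspaces of S_m for lam and -lam together span the kernel of the
contraction with m, whose dimension is binomial (n-1) ((n-1)/2). Since S_(-m) = - S_m, the eigenspaces of S_m
and S_(-m) for the same lam have exactly this total dimension, and summing over the symmetric set of all m with
|m| = |lam| / (2 pi) produces the factor 1/2 without determining the individual dimensions. *)

theory Submission
  imports Defs
begin

section \<open>Uniqueness of Fourier coefficients in one variable\<close>

text \<open>Completeness of the characters enters as uniqueness: a continuous periodic function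
  whose Fourier coefficients all vanish is zero. An eigenform has only finitely many nonzero
  coefficients, because dual vectors of a fixed length form a finite set; subtracting the finite sum
  of its modes leaves a function to which uniqueness applies. A lattice basis need not be
  orthogonal, so uniqueness is reduced to the circle by averaging along one basis vector at a time;
  on the circle it follows from polynomial approximation. The case distinction in curl is what makes
  the square of the symbol a positive multiple. With \<open>n = 2 * k + 1\<close>, the two Hodge
  signs contribute \<open>(- 1) ^ k\<close> and the two derivatives contribute a negative factor;
  the extra \<open>\<i>\<close> in curl is present exactly when \<open>k\<close> is even and
  supplies the missing sign there.\<close>

lemma cis_int_multiple [simp]: "k \<in> \<int> \<Longrightarrow> cis (2 * pi * k) = 1"
  by (auto elim!: Ints_cases simp: cis_multiple_2pi)

lemma periodic_add_of_int:
  fixes g :: "real \<Rightarrow> 'b"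
  assumes per: "\<And>t. g (t + 1) = g t"
  shows "g (t + of_int k) = g t"
proof (induction k arbitrary: t rule: int_induct[where k = 0])
  case (step1 i)
  have "g (t + of_int (i + 1)) = g ((t + of_int i) + 1)" by (simp add: algebra_simps)
  then show ?case using step1 per by metis
next
  case (step2 i)
  have "g (t + of_int i) = g ((t + of_int (i - 1)) + 1)" by (simp add: algebra_simps)
  then show ?case using step2 per by metis
qed auto

text \<open>For a shift \<open>u\<close> in the unit interval, splitting \<open>{0..u+1}\<close> at
  \<open>u\<close> and at \<open>1\<close> gives two expressions for the same integral, and
  periodicity identifies the outer pieces. A general shift is reduced to its fractional
  part.\<close>

lemma integral_periodic_shift:
  fixes g :: "real \<Rightarrow> complex"
  assumes cont: "continuous_on UNIV g" and per: "\<And>t. g (t + 1) = g t"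
  shows "integral {0..1} (\<lambda>t. g (t + s)) = integral {0..1} g"
proof -
  have int: "g integrable_on {a..b}" for a b
    by (intro integrable_continuous_real continuous_on_subset[OF cont]) auto
  have shift: "integral {a..b} (\<lambda>t. g (t + c)) = integral {a+c..b+c} g" for a b c
    using integral_shift_Icc_real[of a b g c] by (simp add: o_def add.commute)
  have nonneg: "integral {u..u+1} g = integral {0..1} g" if "0 \<le> u" "u \<le> 1" for u
  proof -
    have "integral {0..u} g + integral {u..u+1} g = integral {0..u+1} g"
      using that by (intro Henstock_Kurzweil_Integration.integral_combine int) auto
    moreover have "integral {0..1} g + integral {1..u+1} g = integral {0..u+1} g"
      using that by (intro Henstock_Kurzweil_Integration.integral_combine int) auto
    moreover have "integral {1..u+1} g = integral {0..u} g"
      using shift[of 0 u 1] by (simp add: per)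
    ultimately show ?thesis by (metis add.commute add_right_cancel)
  qed
  note per_int = periodic_add_of_int[of g, OF per]
  have "integral {0..1} (\<lambda>t. g (t + s)) = integral {0..1} (\<lambda>t. g ((t + frac s) + of_int \<lfloor>s\<rfloor>))"
    by (simp add: frac_def)
  also have "\<dots> = integral {0..1} (\<lambda>t. g (t + frac s))" by (simp only: per_int)
  also have "\<dots> = integral {frac s..frac s + 1} g"
    using shift[of 0 1 "frac s"] by (simp add: add.commute)
  also have "\<dots> = integral {0..1} g"
    by (rule nonneg) (auto simp: less_imp_le frac_lt_1)
  finally show ?thesis .
qed

text \<open>Frequencies are integer-valued reals because they later arise as inner products.
  Continuity is included so that the property can be propagated through products.\<close>

definition vanishing_coeffs :: "(real \<Rightarrow> complex) \<Rightarrow> bool" where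
  "vanishing_coeffs h \<longleftrightarrow> continuous_on UNIV h \<and>
     (\<forall>k\<in>\<int>. integral {0..1} (\<lambda>t. cis (- (2 * pi * k * t)) * h t) = 0)"

text \<open>On the circle a real linear functional is a combination of \<open>cis x\<close> and
  \<open>cis (- x)\<close>, and multiplying by either one moves every frequency by one. Products are
  handled by applying the induction twice, which is why \<open>h\<close> is left arbitrary.\<close>

lemma vanishing_coeffs_polynomial:
  assumes "real_polynomial_function q" "vanishing_coeffs h"
  shows "vanishing_coeffs (\<lambda>t. of_real (q (cis (2 * pi * t))) * h t)"
  using assms
proof (induction arbitrary: h rule: real_polynomial_function.induct)
  case (linear f)
  have c: "continuous_on S h" for S
    using linear.prems continuous_on_subset unfolding vanishing_coeffs_def by blast
  define a b where "a = f 1" and "b = f \<i>"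
  have fab: "f z = a * Re z + b * Im z" for z
  proof -
    have "z = Re z *\<^sub>R 1 + Im z *\<^sub>R \<i>" by (simp add: complex_eq_iff)
    then have "f z = f (Re z *\<^sub>R 1 + Im z *\<^sub>R \<i>)" by simp
    then show ?thesis unfolding a_def b_def
      using linear.hyps by (simp add: linear_simps bounded_linear.linear linear_add linear_scale)
  qed
  have fe: "complex_of_real (f (cis x)) =
       (of_real a / 2 - \<i> * of_real b / 2) * cis x
       + (of_real a / 2 + \<i> * of_real b / 2) * cis (- x)" for x
    unfolding fab by (simp add: complex_eq_iff)
  define A B where "A = complex_of_real a / 2 - \<i> * of_real b / 2"
    and "B = complex_of_real a / 2 + \<i> * of_real b / 2"
  have eq: "cis (- (2 * pi * k * t)) * (of_real (f (cis (2 * pi * t))) * h t) =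
     A * (cis (- (2 * pi * (k - 1) * t)) * h t) + B * (cis (- (2 * pi * (k + 1) * t)) * h t)" for k t
  proof -
    have "cis (- (2 * pi * (k - 1) * t)) = cis (- (2 * pi * k * t)) * cis (2 * pi * t)"
      "cis (- (2 * pi * (k + 1) * t)) = cis (- (2 * pi * k * t)) * cis (- (2 * pi * t))"
      unfolding cis_mult by (simp_all add: algebra_simps)
    then show ?thesis unfolding fe[folded A_def B_def] by (simp add: algebra_simps)
  qed
  have i: "(\<lambda>t. C * (cis (- (2 * pi * k * t)) * h t)) integrable_on {0..1}" for C k
    by (intro integrable_continuous_real continuous_intros c)
  have "integral {0..1} (\<lambda>t. cis (- (2 * pi * k * t)) * (of_real (f (cis (2 * pi * t))) * h t)) = 0"
    if "k \<in> \<int>" for k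
    unfolding eq using linear.prems that
    by (subst integral_add[OF i i]) (simp add: vanishing_coeffs_def)
  moreover have "continuous_on UNIV (\<lambda>t. complex_of_real (f (cis (2 * pi * t))) * h t)"
    by (intro continuous_intros c bounded_linear.continuous_on[OF linear.hyps])
  ultimately show ?case by (simp add: vanishing_coeffs_def)
next
  case (const c)
  have "(\<lambda>t. cis (- (2 * pi * k * t)) * (of_real c * h t)) = (\<lambda>t. of_real c * (cis (- (2 * pi * k * t)) * h t))" for k
    by (auto simp: algebra_simps)
  with const show ?case by (auto simp: vanishing_coeffs_def intro!: continuous_intros)
next
  case (add f g)
  note F = add.IH(1)[OF add.prems, unfolded vanishing_coeffs_def]
  note G = add.IH(2)[OF add.prems, unfolded vanishing_coeffs_def]
  have i: "(\<lambda>t. cis (- (2 * pi * k * t)) * u t) integrable_on {0..1}"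
    if "continuous_on UNIV u" for u k
    by (intro integrable_continuous_real continuous_intros continuous_on_subset[OF that]) auto
  show ?case
    unfolding vanishing_coeffs_def
    using F G by (auto simp: ring_distribs integral_add[OF i i] intro!: continuous_on_add)
next
  case (mult f g)
  from mult.IH(1)[OF mult.IH(2)[OF mult.prems]] show ?case
    by (simp add: algebra_simps)
qed

text \<open>The conjugate of any polynomial on the circle integrates to zero against
  \<open>g\<close>. Replacing it by a uniform approximation of the conjugate of \<open>g\<close>
  shows that the squared L2 norm of \<open>g\<close> is below every positive bound.\<close>

lemma fourier_uniqueness_1d:
  fixes g :: "real \<Rightarrow> complex"
  assumes van: "vanishing_coeffs g" and per: "\<And>t. g (t + 1) = g t"
  shows "g t = 0"
proof -
  have cont: "continuous_on S g" for S
    using van continuous_on_subset unfolding vanishing_coeffs_def by blast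
  note per_int = periodic_add_of_int[of g, OF per]
  have cis_eq: "g s = g t" if "cis (2 * pi * s) = cis (2 * pi * t)" for s t
  proof -
    from that obtain n :: int where "2 * pi * s = 2 * pi * t + 2 * pi * of_int n"
      by (metis cis.sel sin_cos_eq_iff)
    then have "2 * pi * s = 2 * pi * (t + of_int n)" by (simp only: distrib_left)
    then have "s = t + of_int n" by simp
    then show ?thesis by (simp add: per_int)
  qed
  txt \<open>The function induced by g on the unit circle is continuous because its graph is the
    compact image of the unit interval.\<close>
  define F where "F z = g (SOME s. cis (2 * pi * s) = z)" for z
  have F: "F (cis (2 * pi * t)) = g t" for t
    unfolding F_def by (rule cis_eq, rule someI) simp
  have circle: "(\<lambda>t. cis (2 * pi * t)) ` {0..1} = sphere 0 1"
  proof (intro equalityI subsetI)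
    fix z :: complex assume "z \<in> sphere 0 1"
    then have "z = cis (2 * pi * (Arg2pi z / (2 * pi)))"
      using Arg2pi[of z] by (simp add: cis_conv_exp is_Arg_def mult.commute)
    moreover have "Arg2pi z / (2 * pi) \<in> {0..1}"
      using Arg2pi[of z] by (auto simp: field_simps)
    ultimately show "z \<in> (\<lambda>t. cis (2 * pi * t)) ` {0..1}" by blast
  qed auto
  have contF: "continuous_on (sphere 0 1) F"
  proof (rule continuous_from_closed_graph)
    show "compact (g ` {0..1})" by (intro compact_continuous_image cont) simp
    show "F \<in> sphere 0 1 \<rightarrow> g ` {0..1}"
      unfolding circle[symmetric] using F by auto
    have "(\<lambda>z. (z, F z)) ` sphere 0 1 = (\<lambda>t. (cis (2 * pi * t), g t)) ` {0..1}"
      unfolding circle[symmetric] image_image F ..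
    moreover have "compact ((\<lambda>t. (cis (2 * pi * t), g t)) ` {0..1})"
      by (intro compact_continuous_image continuous_intros cont) simp
    ultimately show "closed ((\<lambda>z. (z, F z)) ` sphere 0 1)"
      by (simp add: compact_imp_closed)
  qed
  have "bounded (g ` {0..1})" by (intro compact_imp_bounded compact_continuous_image cont) simp
  then obtain M where M: "M > 0" "\<And>t. t \<in> {0..1} \<Longrightarrow> norm (g t) \<le> M"
    unfolding bounded_pos by auto
  let ?I = "integral {0..1} (\<lambda>t. cnj (g t) * g t)"
  have small: "norm ?I \<le> e * M" if e: "e > 0" for e
  proof -
    obtain p where p: "polynomial_function p" "\<And>z. z \<in> sphere 0 1 \<Longrightarrow> norm (F z - p z) < e"
      using Stone_Weierstrass_polynomial_function[OF compact_sphere contF e] by auto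
    let ?q = "\<lambda>t. p (cis (2 * pi * t))"
    \<comment> \<open>A complex \<open>polynomial_function\<close> is given by its compositions with
      real functionals, so its real and imaginary parts are treated separately. The zeroth
      coefficient of each product is its plain integral.\<close>
    have Re: "vanishing_coeffs (\<lambda>t. of_real (Re (?q t)) * g t)"
      using vanishing_coeffs_polynomial[OF _ van, of "Re \<circ> p"] p(1) bounded_linear_Re
      unfolding polynomial_function_def by (simp add: o_def)
    have Im: "vanishing_coeffs (\<lambda>t. of_real (Im (?q t)) * g t)"
      using vanishing_coeffs_polynomial[OF _ van, of "Im \<circ> p"] p(1) bounded_linear_Im
      unfolding polynomial_function_def by (simp add: o_def)
    have cq: "continuous_on {0..1} ?q"
      by (intro continuous_on_compose2[OF continuous_on_polymonial_function[OF p(1)]] continuous_intros) auto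
    have "integral {0..1} (\<lambda>t. of_real (Re (?q t)) * g t) = 0"
      "integral {0..1} (\<lambda>t. of_real (Im (?q t)) * g t) = 0"
      using Re Im Ints_0 unfolding vanishing_coeffs_def
      by (auto dest!: conjunct2 bspec[of _ _ 0])
    moreover have "cnj (?q t) * g t = of_real (Re (?q t)) * g t - \<i> * (of_real (Im (?q t)) * g t)" for t
      by (simp add: complex_eq_iff algebra_simps)
    moreover have "(\<lambda>t. of_real (Re (?q t)) * g t) integrable_on {0..1}"
       "(\<lambda>t. \<i> * (of_real (Im (?q t)) * g t)) integrable_on {0..1}"
      by (intro integrable_continuous_real continuous_intros cont cq)+
    ultimately have 0: "integral {0..1} (\<lambda>t. cnj (?q t) * g t) = 0"
      by (simp add: integral_diff)
    have "?I = integral {0..1} (\<lambda>t. cnj (g t) * g t) - integral {0..1} (\<lambda>t. cnj (?q t) * g t)"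
      using 0 by simp
    also have "\<dots> = integral {0..1} (\<lambda>t. cnj (g t - ?q t) * g t)"
    proof (subst integral_diff[symmetric])
      show "integral {0..1} (\<lambda>t. cnj (g t) * g t - cnj (?q t) * g t) = integral {0..1} (\<lambda>t. cnj (g t - ?q t) * g t)"
        by (simp add: left_diff_distrib)
    qed (intro integrable_continuous_real continuous_intros cont cq)+
    also have "norm \<dots> \<le> (e * M) * (1 - 0)"
    proof (rule integral_bound)
      show "continuous_on {0..1} (\<lambda>t. cnj (g t - ?q t) * g t)"
        by (intro continuous_intros cont cq)
      fix t :: real assume t: "t \<in> {0..1}"
      have "norm (g t - ?q t) \<le> e" using p(2)[of "cis (2 * pi * t)"] by (simp add: F less_imp_le)
      then show "norm (cnj (g t - ?q t) * g t) \<le> e * M"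
        unfolding norm_mult complex_mod_cnj using M(2)[OF t] e by (intro mult_mono) auto
    qed simp
    finally show ?thesis by simp
  qed
  have "norm ?I \<le> 0 + d" if "d > 0" for d
    using small[of "d / M"] M(1) that by simp
  then have "?I = 0" using field_le_epsilon[of "norm ?I" 0] by simp
  moreover have "?I = integral {0..1} (\<lambda>t. of_real ((norm (g t))\<^sup>2))"
    by (simp only: complex_norm_square mult.commute)
  moreover have "\<dots> = of_real (integral {0..1} (\<lambda>t. (norm (g t))\<^sup>2))"
    by (rule integral_linear[OF _ bounded_linear_of_real, unfolded o_def])
      (intro integrable_continuous_real continuous_intros cont)
  ultimately have "integral {0..1} (\<lambda>t. (norm (g t))\<^sup>2) = 0" by simp
  then have "\<forall>t\<in>{0..1}. (norm (g t))\<^sup>2 = 0"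
    by (subst (asm) integral_eq_0_iff) (auto intro!: continuous_intros cont)
  then have "g (frac t) = 0" by (auto simp: less_imp_le frac_lt_1)
  then show ?thesis using per_int[of "frac t" "\<lfloor>t\<rfloor>"] by (simp add: frac_def)
qed

section \<open>Fourier projections along a lattice basis\<close>

text \<open>Integrating over one period along a single lattice vector at a time makes all properties of
  the Fourier projection follow from one-dimensional facts, for arbitrary lattices.\<close>

definition avg :: "'a::euclidean_space \<Rightarrow> real \<Rightarrow> ('a \<Rightarrow> complex) \<Rightarrow> 'a \<Rightarrow> complex" where
  "avg b k f x = integral {0..1} (\<lambda>t. cis (- (2 * pi * k * t)) * f (x + t *\<^sub>R b))"

text \<open>The frequencies are a function of the basis vector: \<open>inner m\<close> yields the
  projection onto \<open>char_mode m\<close>, while the uniqueness induction varies them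
  independently.\<close>

fun proj_mode :: "'a::euclidean_space list \<Rightarrow> ('a \<Rightarrow> real) \<Rightarrow> ('a \<Rightarrow> complex) \<Rightarrow> 'a \<Rightarrow> complex" where
  "proj_mode [] k f = f"
| "proj_mode (b # bs) k f = avg b (k b) (proj_mode bs k f)"

lemma continuous_on_avg:
  assumes "continuous_on UNIV f"
  shows "continuous_on UNIV (avg b k f)"
proof -
  have "continuous_on UNIV (\<lambda>x. integral (cbox 0 1) (\<lambda>t. cis (- (2 * pi * k * t)) * f (x + t *\<^sub>R b)))"
    by (rule integral_continuous_on_param)
      (auto simp: case_prod_unfold intro!: continuous_intros continuous_on_compose2[OF assms])
  then show ?thesis by (simp add: avg_def[abs_def])
qed

lemma continuous_on_proj_mode:
  "continuous_on UNIV f \<Longrightarrow> continuous_on UNIV (proj_mode bs k f)"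
  by (induction bs) (auto simp: continuous_on_avg)

lemma continuous_on_line:
  fixes f :: "'a::real_normed_vector \<Rightarrow> complex"
  assumes "continuous_on UNIV f"
  shows "continuous_on S (\<lambda>t::real. f (x + t *\<^sub>R b))"
  by (rule continuous_on_compose2[OF assms]) (auto intro!: continuous_intros)

lemma integrable_avg:
  fixes f :: "'a::real_normed_vector \<Rightarrow> complex"
  assumes "continuous_on UNIV f"
  shows "(\<lambda>t. cis (- (2 * pi * k * t)) * f (x + t *\<^sub>R b)) integrable_on {0..1}"
  by (intro integrable_continuous_real continuous_on_mult continuous_on_line assms)
    (intro continuous_intros)

lemma avg_add:
  assumes "continuous_on UNIV f" "continuous_on UNIV g"
  shows "avg b k (\<lambda>x. f x + g x) = (\<lambda>x. avg b k f x + avg b k g x)"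
  using assms by (simp add: fun_eq_iff avg_def ring_distribs integral_add integrable_avg)

lemma avg_scale: "avg b k (\<lambda>x. c * f x) = (\<lambda>x. c * avg b k f x)"
proof
  fix x
  have "cis (- (2 * pi * k * t)) * (c * f y) = c * (cis (- (2 * pi * k * t)) * f y)" for t y
    by (rule mult.left_commute)
  then show "avg b k (\<lambda>x. c * f x) x = c * avg b k f x"
    by (simp only: avg_def integral_mult_right)
qed

lemma proj_mode_add:
  assumes "continuous_on UNIV f" "continuous_on UNIV g"
  shows "proj_mode bs k (\<lambda>x. f x + g x) = (\<lambda>x. proj_mode bs k f x + proj_mode bs k g x)"
  by (induction bs) (simp_all add: avg_add assms continuous_on_proj_mode)

lemma proj_mode_scale: "proj_mode bs k (\<lambda>x. c * f x) = (\<lambda>x. c * proj_mode bs k f x)"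
  by (induction bs) (simp_all add: avg_scale)

lemma proj_mode_sum:
  assumes "\<And>i. i \<in> I \<Longrightarrow> continuous_on UNIV (f i)"
  shows "proj_mode bs k (\<lambda>x. \<Sum>i\<in>I. f i x) = (\<lambda>x. \<Sum>i\<in>I. proj_mode bs k (f i) x)"
  using assms
proof (induction I rule: infinite_finite_induct)
  case (insert i I)
  then show ?case
    by (simp add: proj_mode_add continuous_on_sum)
qed (use proj_mode_scale[of bs k 0 "\<lambda>_. 0"] in auto)

lemma avg_translate: "avg b k (\<lambda>x. f (x + a)) = (\<lambda>x. avg b k f (x + a))"
  by (simp add: fun_eq_iff avg_def add_ac)

lemma proj_mode_translate: "proj_mode bs k (\<lambda>x. f (x + a)) = (\<lambda>x. proj_mode bs k f (x + a))"
  by (induction bs) (simp_all add: avg_translate)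

lemma proj_mode_periodic:
  assumes "\<And>x. f (x + a) = f x"
  shows "proj_mode bs k f (x + a) = proj_mode bs k f x"
  using fun_cong[OF proj_mode_translate[of bs k f a], of x] assms by simp

text \<open>With \<open>k\<close> an integer the twisted integrand \<open>g\<close> has period 1 in
  \<open>t\<close>. Translating \<open>x\<close> by \<open>s *\<^sub>R b\<close> therefore only
  shifts the argument of \<open>g\<close>, which the integral over a period ignores, and a phase
  remains.\<close>

lemma avg_equivariant:
  assumes cont: "continuous_on UNIV f" and per: "\<And>x. f (x + b) = f x" and k: "k \<in> \<int>"
  shows "avg b k f (x + s *\<^sub>R b) = cis (2 * pi * k * s) * avg b k f x"
proof -
  define g where "g t = cis (- (2 * pi * k * t)) * f (x + t *\<^sub>R b)" for t
  have g1: "g (t + 1) = g t" for t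
  proof -
    have "cis (- (2 * pi * k * (t + 1))) = cis (- (2 * pi * k * t)) * cis (2 * pi * (- k))"
      by (simp add: cis_mult algebra_simps)
    moreover have "f (x + (t + 1) *\<^sub>R b) = f (x + t *\<^sub>R b)"
      using per[of "x + t *\<^sub>R b"] by (simp add: algebra_simps)
    moreover have "cis (2 * pi * (- k)) = 1" by (rule cis_int_multiple) (use k in auto)
    ultimately show ?thesis by (simp add: g_def)
  qed
  have "cis (- (2 * pi * k * t)) * f (x + s *\<^sub>R b + t *\<^sub>R b) = cis (2 * pi * k * s) * g (t + s)" for t
  proof -
    have "cis (- (2 * pi * k * t)) = cis (2 * pi * k * s) * cis (- (2 * pi * k * (t + s)))"
      by (simp add: cis_mult algebra_simps)
    then show ?thesis by (simp add: g_def algebra_simps)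
  qed
  then have "avg b k f (x + s *\<^sub>R b) = cis (2 * pi * k * s) * integral {0..1} (\<lambda>t. g (t + s))"
    by (simp add: avg_def)
  also have "integral {0..1} (\<lambda>t. g (t + s)) = integral {0..1} g"
  proof (rule integral_periodic_shift)
    show "continuous_on UNIV g"
      unfolding g_def[abs_def] by (intro continuous_on_mult continuous_on_line cont) (intro continuous_intros)
  qed (rule g1)
  finally show ?thesis by (simp add: avg_def g_def[abs_def])
qed

lemma avg_preserves_equivariance:
  assumes "\<And>x. f (x + a) = c * f x"
  shows "avg b k f (x + a) = c * avg b k f x"
  using fun_cong[OF avg_translate[of b k f a], of x] assms by (simp add: avg_scale)

text \<open>The average along \<open>b\<close> itself creates the phase; averages along the other
  vectors commute with translations and preserve it.\<close>

lemma proj_mode_equivariant: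
  assumes cont: "continuous_on UNIV f" and per: "\<And>b x. b \<in> set bs \<Longrightarrow> f (x + b) = f x"
    and k: "\<And>b. b \<in> set bs \<Longrightarrow> k b \<in> \<int>" and "b \<in> set bs"
  shows "proj_mode bs k f (x + s *\<^sub>R b) = cis (2 * pi * k b * s) * proj_mode bs k f x"
  using assms(2-)
proof (induction bs arbitrary: x)
  case (Cons a bs)
  show ?case
  proof (cases "a = b")
    case True
    then show ?thesis
      using Cons.prems by (auto intro!: avg_equivariant continuous_on_proj_mode cont proj_mode_periodic)
  next
    case False
    then show ?thesis
      using Cons by (auto intro!: avg_preserves_equivariance)
  qed
qed simp

section \<open>Characters and their Fourier projections\<close>

definition char_mode :: "'a::euclidean_space \<Rightarrow> 'a \<Rightarrow> complex" where
  "char_mode m x = cis (2 * pi * (m \<bullet> x))"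

lemma char_mode_0 [simp]: "char_mode m 0 = 1"
  by (simp add: char_mode_def)

lemma char_mode_nonzero [simp]: "char_mode m x \<noteq> 0"
  by (simp add: char_mode_def)

lemma continuous_on_char_mode [continuous_intros]: "continuous_on S (char_mode m)"
  unfolding char_mode_def[abs_def] by (intro continuous_intros)

lemma char_mode_add: "char_mode m (x + y) = char_mode m x * char_mode m y"
  by (simp add: char_mode_def cis_mult inner_add_right algebra_simps)

text \<open>Equivariance holds for all real multiples of the basis vectors, so induction over their
  real span gives the translation law for every vector. The base point is quantified inside
  \<open>?P\<close> because each step moves it.\<close>

lemma proj_mode_eq_char_mode:
  fixes f :: "'a::euclidean_space \<Rightarrow> complex"
  assumes cont: "continuous_on UNIV f" and per: "\<And>b x. b \<in> set bs \<Longrightarrow> f (x + b) = f x"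
    and m: "\<And>b. b \<in> set bs \<Longrightarrow> m \<bullet> b \<in> \<int>" and span: "span (set bs) = UNIV"
  shows "proj_mode bs (inner m) f x = char_mode m x * proj_mode bs (inner m) f 0"
proof -
  let ?P = "\<lambda>y. \<forall>x. proj_mode bs (inner m) f (x + y) = char_mode m y * proj_mode bs (inner m) f x"
  have "x \<in> span (set bs)" using span by simp
  then have "?P x"
  proof (induction rule: span_induct_alt)
    case (step s b y)
    show ?case
    proof
      fix x
      have "proj_mode bs (inner m) f (x + (s *\<^sub>R b + y)) = proj_mode bs (inner m) f ((x + y) + s *\<^sub>R b)"
        by (simp add: add_ac)
      also have "\<dots> = char_mode m (s *\<^sub>R b) * proj_mode bs (inner m) f (x + y)"
        using proj_mode_equivariant[of f bs "inner m" b "x + y" s, OF cont per m \<open>b \<in> set bs\<close>]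
        by (simp add: char_mode_def mult_ac)
      finally show "proj_mode bs (inner m) f (x + (s *\<^sub>R b + y)) = char_mode m (s *\<^sub>R b + y) * proj_mode bs (inner m) f x"
        using step by (simp add: char_mode_add)
    qed
  qed simp
  from spec[OF this, of 0] show ?thesis by simp
qed

lemma integral_cis_int:
  assumes "k \<in> \<int>"
  shows "integral {0..1} (\<lambda>t. cis (2 * pi * k * t)) = (if k = 0 then 1 else 0)"
proof (cases "k = 0")
  case False
  define c where "c = \<i> * of_real (2 * pi * k)"
  have c: "c \<noteq> 0" using False by (simp add: c_def)
  have "((\<lambda>t. exp (c * of_real t)) has_integral
       exp (c * of_real 1) / c - exp (c * of_real 0) / c) {0..1}"
  proof (rule fundamental_theorem_of_calculus)
    fix t :: real
    show "((\<lambda>t. exp (c * of_real t) / c) has_vector_derivative exp (c * of_real t)) (at t within {0..1})"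
      by (rule has_vector_derivative_real_field) (use c in \<open>auto intro!: derivative_eq_intros\<close>)
  qed simp
  moreover have "exp (c * of_real t) = cis (2 * pi * k * t)" for t
    by (simp add: c_def cis_conv_exp mult.assoc)
  ultimately have "((\<lambda>t. cis (2 * pi * k * t)) has_integral
      cis (2 * pi * k * 1) / c - cis (2 * pi * k * 0) / c) {0..1}"
    by (simp only:)
  then have "((\<lambda>t. cis (2 * pi * k * t)) has_integral 0) {0..1}"
    using assms by simp
  then show ?thesis using False assms by (simp add: integral_unique)
qed simp

lemma avg_char_mode:
  assumes "m \<bullet> b - k \<in> \<int>"
  shows "avg b k (char_mode m) = (\<lambda>x. (if m \<bullet> b = k then 1 else 0) * char_mode m x)"
proof
  fix x
  have "cis (- (2 * pi * k * t)) * char_mode m (x + t *\<^sub>R b) = char_mode m x * cis (2 * pi * (m \<bullet> b - k) * t)" for t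
    by (simp add: char_mode_def cis_mult inner_add_right algebra_simps)
  then show "avg b k (char_mode m) x = (if m \<bullet> b = k then 1 else 0) * char_mode m x"
    using integral_cis_int[OF assms] by (simp add: avg_def)
qed

text \<open>Each average tests one inner product. If all of them agree on a spanning set,
  \<open>m - l\<close> is orthogonal to itself.\<close>

lemma proj_mode_char_mode:
  assumes "\<And>b. b \<in> set bs \<Longrightarrow> m \<bullet> b \<in> \<int>" "\<And>b. b \<in> set bs \<Longrightarrow> l \<bullet> b \<in> \<int>"
    and "span (set bs) = UNIV"
  shows "proj_mode bs (inner l) (char_mode m) = (\<lambda>x. (if m = l then 1 else 0) * char_mode m x)"
proof -
  have *: "proj_mode bs (inner l) (char_mode m) =
     (\<lambda>x. (if \<forall>b\<in>set bs. m \<bullet> b = l \<bullet> b then 1 else 0) * char_mode m x)"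
    using assms(1,2) by (induction bs) (auto simp: avg_scale avg_char_mode)
  have "(\<forall>b\<in>set bs. m \<bullet> b = l \<bullet> b) \<longleftrightarrow> m = l"
  proof
    assume "\<forall>b\<in>set bs. m \<bullet> b = l \<bullet> b"
    then have "orthogonal (m - l) b" if "b \<in> set bs" for b
      using that by (simp add: orthogonal_def inner_diff_left)
    moreover have "m - l \<in> span (set bs)" using assms(3) by simp
    ultimately have "orthogonal (m - l) (m - l)"
      by (meson orthogonal_to_span)
    then show "m = l" by (simp add: orthogonal_self)
  qed simp
  with * show ?thesis by simp
qed

lemma proj_mode_cong:
  "(\<And>b. b \<in> set bs \<Longrightarrow> k b = k' b) \<Longrightarrow> proj_mode bs k f = proj_mode bs k' f"
  by (induction bs) auto

text \<open>Fix the frequencies of all vectors but the head \<open>b\<close>. Along a line in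
  direction \<open>b\<close>, the projection over the remaining vectors has all its one-dimensional
  coefficients zero, so it vanishes, and the induction continues with one vector fewer.\<close>

lemma proj_mode_uniqueness:
  assumes "continuous_on UNIV f" "\<And>b x. b \<in> set bs \<Longrightarrow> f (x + b) = f x" "distinct bs"
    and "\<And>k. (\<And>b. k b \<in> \<int>) \<Longrightarrow> proj_mode bs k f = (\<lambda>_. 0)"
  shows "f = (\<lambda>_. 0)"
  using assms(2-)
proof (induction bs)
  case Nil
  from Nil(3)[of "\<lambda>_. 0"] show ?case by simp
next
  case (Cons b bs)
  have "proj_mode bs k f x = 0" if k: "\<And>b. k b \<in> \<int>" for k x
  proof -
    define g where "g t = proj_mode bs k f (x + t *\<^sub>R b)" for t
    have "integral {0..1} (\<lambda>t. cis (- (2 * pi * j * t)) * g t) = 0" if "j \<in> \<int>" for j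
    proof -
      \<comment> \<open>Distinctness keeps \<open>b\<close> out of \<open>bs\<close>, so its
        frequency can be varied without affecting the inner projection.\<close>
      have "proj_mode bs (k(b := j)) f = proj_mode bs k f"
        using Cons.prems(2) by (intro proj_mode_cong) auto
      moreover have "proj_mode (b # bs) (k(b := j)) f x = 0"
        by (rule fun_cong[OF Cons.prems(3)]) (use k that in auto)
      ultimately show ?thesis by (simp add: avg_def g_def)
    qed
    moreover have "continuous_on UNIV g"
      unfolding g_def[abs_def] by (intro continuous_on_line continuous_on_proj_mode assms(1))
    ultimately have "vanishing_coeffs g" by (simp add: vanishing_coeffs_def)
    moreover have "g (t + 1) = g t" for t
      using proj_mode_periodic[of f b bs k "x + t *\<^sub>R b"] Cons.prems(1)[of b]
      by (simp add: g_def algebra_simps)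
    ultimately have "g 0 = 0" by (rule fourier_uniqueness_1d)
    then show ?thesis by (simp add: g_def)
  qed
  with Cons show ?case by auto
qed

section \<open>Differentiation under the averages\<close>

text \<open>Continuity of both functions is bundled because the Leibniz rule requires it and
  averaging preserves it. A derivative at parameter 0 for every base point amounts to a derivative
  everywhere on each line.\<close>

definition has_deriv_along :: "'a::euclidean_space \<Rightarrow> ('a \<Rightarrow> complex) \<Rightarrow> ('a \<Rightarrow> complex) \<Rightarrow> bool" where
  "has_deriv_along e f f' \<longleftrightarrow> continuous_on UNIV f \<and> continuous_on UNIV f' \<and>
     (\<forall>x. ((\<lambda>t. f (x + t *\<^sub>R e)) has_vector_derivative f' x) (at 0))"

lemma has_deriv_along_avg:
  assumes "has_deriv_along e f f'"
  shows "has_deriv_along e (avg b k f) (avg b k f')"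
proof -
  have c: "continuous_on UNIV f" "continuous_on UNIV f'"
    and d0: "\<And>x. ((\<lambda>t. f (x + t *\<^sub>R e)) has_vector_derivative f' x) (at 0)"
    using assms by (auto simp: has_deriv_along_def)
  have d: "((\<lambda>t. f (x + t *\<^sub>R e)) has_vector_derivative f' (x + s *\<^sub>R e)) (at s)" for x s
  proof -
    have "((\<lambda>t. f (x + s *\<^sub>R e + t *\<^sub>R e)) has_vector_derivative f' (x + s *\<^sub>R e)) (at (s - s))"
      using d0[of "x + s *\<^sub>R e"] by simp
    moreover have "((\<lambda>t. t - s) has_vector_derivative 1) (at s)"
      by (auto intro!: derivative_eq_intros)
    ultimately have "((\<lambda>t. f (x + s *\<^sub>R e + (t - s) *\<^sub>R e)) has_vector_derivative f' (x + s *\<^sub>R e)) (at s)"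
      using vector_diff_chain_at[of "\<lambda>t. t - s" 1 s "\<lambda>t. f (x + s *\<^sub>R e + t *\<^sub>R e)"]
      unfolding o_def by simp
    moreover have "x + s *\<^sub>R e + (t - s) *\<^sub>R e = x + t *\<^sub>R e" for t
      by (simp add: scaleR_diff_left)
    ultimately show ?thesis by simp
  qed
  have "((\<lambda>s. avg b k f (x + s *\<^sub>R e)) has_vector_derivative avg b k f' x) (at 0)" for x
  proof -
    have "((\<lambda>s. integral (cbox 0 1) (\<lambda>t. cis (- (2 * pi * k * t)) * f (x + t *\<^sub>R b + s *\<^sub>R e)))
      has_vector_derivative integral (cbox 0 1) (\<lambda>t. cis (- (2 * pi * k * t)) * f' (x + t *\<^sub>R b + 0 *\<^sub>R e)))
      (at 0 within UNIV)"
    proof (rule leibniz_rule_vector_derivative)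
      fix s t :: real
      show "((\<lambda>s. cis (- (2 * pi * k * t)) * f (x + t *\<^sub>R b + s *\<^sub>R e)) has_vector_derivative
         cis (- (2 * pi * k * t)) * f' (x + t *\<^sub>R b + s *\<^sub>R e)) (at s within UNIV)"
        by (intro has_vector_derivative_mult_right d)
      show "(\<lambda>t. cis (- (2 * pi * k * t)) * f (x + t *\<^sub>R b + s *\<^sub>R e)) integrable_on cbox 0 1"
        using integrable_avg[OF c(1), of k "x + s *\<^sub>R e" b] by (simp add: add_ac)
      have "continuous_on (UNIV \<times> cbox 0 1) (\<lambda>z. f' (x + snd z *\<^sub>R b + fst z *\<^sub>R e))"
        by (rule continuous_on_compose2[OF c(2)]) (auto intro!: continuous_intros)
      then show "continuous_on (UNIV \<times> cbox 0 1)
          (\<lambda>(s, t). cis (- (2 * pi * k * t)) * f' (x + t *\<^sub>R b + s *\<^sub>R e))"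
        unfolding case_prod_unfold by (intro continuous_on_mult) (auto intro!: continuous_intros)
    qed auto
    then show ?thesis by (simp add: avg_def add_ac)
  qed
  with c show ?thesis by (simp add: has_deriv_along_def continuous_on_avg)
qed

lemma has_deriv_along_proj_mode:
  "has_deriv_along e f f' \<Longrightarrow> has_deriv_along e (proj_mode bs k f) (proj_mode bs k f')"
  by (induction bs) (auto simp: has_deriv_along_avg)

section \<open>The symbol of curl on constant forms\<close>

text \<open>The sign of moving \<open>dx_j\<close> past the smaller indices in \<open>J\<close>; it
  serves both the exterior product and the contraction.\<close>

definition pos_sign :: "'n::linorder \<Rightarrow> 'n set \<Rightarrow> complex" where
  "pos_sign j J = (- 1) ^ card {i\<in>J. i < j}"

text \<open>Constant forms of all degrees share the single space \<open>complex^('n set)\<close>,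
  graded by \<open>kforms\<close>, so that finite-dimensional complex linear algebra applies
  directly.\<close>

definition wedge :: "real^'n::{finite,linorder} \<Rightarrow> complex^('n set) \<Rightarrow> complex^('n set)" where
  "wedge m v = (\<chi> J. \<Sum>j\<in>J. pos_sign j J * of_real (m $ j) * v $ (J - {j}))"

definition contract :: "real^'n::{finite,linorder} \<Rightarrow> complex^('n set) \<Rightarrow> complex^('n set)" where
  "contract m v = (\<chi> K. \<Sum>i\<in>-K. pos_sign i K * of_real (m $ i) * v $ insert i K)"

definition kforms :: "nat \<Rightarrow> (complex^('n::finite set)) set" where
  "kforms k = {v. \<forall>J. card J \<noteq> k \<longrightarrow> v $ J = 0}"

lemma pos_sign_prod:
  fixes J :: "'n::{finite,linorder} set"
  shows "pos_sign j J = (\<Prod>i\<in>J. if i < j then - 1 else 1)"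
  unfolding pos_sign_def by (simp add: prod.If_cases Int_def)

lemma shuffle_sign_prod:
  fixes A B :: "'n::{finite,linorder} set"
  shows "shuffle_sign A B = (\<Prod>a\<in>A. \<Prod>b\<in>B. if b < a then - 1 else 1)"
proof -
  have "shuffle_sign A B = (\<Prod>(a, b)\<in>A \<times> B. if b < a then - 1 else 1)"
    unfolding shuffle_sign_def
    by (simp add: prod.If_cases case_prod_unfold Int_def) (intro arg_cong[where f="\<lambda>S. (- 1) ^ card S"], auto)
  then show ?thesis by (simp add: prod.cartesian_product)
qed

lemma pos_sign_square [simp]: "pos_sign j J * pos_sign j J = 1"
  by (simp add: pos_sign_def power_mult_distrib[symmetric])

lemma pos_sign_insert:
  fixes K :: "'n::{finite,linorder} set"
  assumes "i \<notin> K"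
  shows "pos_sign j (insert i K) = (if i < j then - 1 else 1) * pos_sign j K"
  using assms by (simp add: pos_sign_prod)

lemma pos_sign_remove:
  fixes K :: "'n::{finite,linorder} set"
  assumes "i \<in> K"
  shows "pos_sign j (K - {i}) = (if i < j then - 1 else 1) * pos_sign j K"
  using pos_sign_insert[of i "K - {i}" j] assms by (simp add: insert_absorb)

lemma linear_wedge: "Vector_Spaces.linear (*s) (*s) (wedge m)"
proof (intro Vector_Spaces.linear_iff[THEN iffD2] conjI allI vec.vector_space_axioms)
  show "wedge m (x + y) = wedge m x + wedge m y" for x y
    by (simp add: wedge_def vec_eq_iff sum.distrib distrib_left)
  show "wedge m (c *s x) = c *s wedge m x" for c x
    by (simp add: wedge_def vec_eq_iff sum_distrib_left mult.left_commute)
qed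

lemma linear_contract: "Vector_Spaces.linear (*s) (*s) (contract m)"
proof (intro Vector_Spaces.linear_iff[THEN iffD2] conjI allI vec.vector_space_axioms)
  show "contract m (x + y) = contract m x + contract m y" for x y
    by (simp add: contract_def vec_eq_iff sum.distrib distrib_left)
  show "contract m (c *s x) = c *s contract m x" for c x
    by (simp add: contract_def vec_eq_iff sum_distrib_left mult.left_commute)
qed

lemma wedge_in_kforms:
  assumes "v \<in> kforms k"
  shows "wedge m v \<in> kforms (Suc k)"
proof -
  have "v $ (J - {j}) = 0" if "card J \<noteq> Suc k" "j \<in> J" for J j
    using assms that card_Suc_Diff1[of J j] by (auto simp: kforms_def)
  then show ?thesis by (auto simp: kforms_def wedge_def intro!: sum.neutral)
qed

lemma contract_in_kforms:
  assumes "v \<in> kforms (Suc k)"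
  shows "contract m v \<in> kforms k"
proof -
  have "v $ insert i K = 0" if "card K \<noteq> k" "i \<notin> K" for K i
    using assms that by (auto simp: kforms_def)
  then show ?thesis by (auto simp: kforms_def contract_def intro!: sum.neutral)
qed

text \<open>The diagonal terms contribute \<open>m $ i * l $ i\<close> for indices outside
  \<open>K\<close> from one summand and inside \<open>K\<close> from the other. The mixed terms
  \<open>X i j\<close> occur in both summands with opposite signs.\<close>

lemma contract_wedge:
  "contract m (wedge l v) + wedge l (contract m v) = of_real (m \<bullet> l) *s v"
proof (rule vec_eq_iff[THEN iffD2], rule allI)
  fix K :: "'a set"
  define X where "X i j = pos_sign i K * pos_sign j (insert i K) * of_real (m $ i) * of_real (l $ j) * v $ (insert i K - {j})" for i j
  have 1: "pos_sign i K * of_real (m $ i) * wedge l v $ insert i K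
      = of_real (m $ i * l $ i) * v $ K + (\<Sum>j\<in>K. X i j)" if "i \<in> - K" for i
  proof -
    from that have "i \<notin> K" by simp
    then have "wedge l v $ insert i K = pos_sign i K * of_real (l $ i) * v $ K
       + (\<Sum>j\<in>K. pos_sign j (insert i K) * of_real (l $ j) * v $ (insert i K - {j}))"
      by (simp add: wedge_def pos_sign_insert)
    then show ?thesis
      by (simp add: X_def distrib_left sum_distrib_left mult_ac)
  qed
  have 2: "pos_sign j K * of_real (l $ j) * contract m v $ (K - {j})
      = of_real (m $ j * l $ j) * v $ K - (\<Sum>i\<in>-K. X i j)" if j: "j \<in> K" for j
  proof -
    have "- (K - {j}) = insert j (- K)" using j by auto
    then have "contract m v $ (K - {j}) = pos_sign j K * of_real (m $ j) * v $ K
       + (\<Sum>i\<in>-K. pos_sign i (K - {j}) * of_real (m $ i) * v $ insert i (K - {j}))"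
      using j by (simp add: contract_def pos_sign_remove insert_absorb)
    moreover have "pos_sign j K * of_real (l $ j) * (pos_sign i (K - {j}) * of_real (m $ i) * v $ insert i (K - {j})) = - X i j"
      if "i \<in> - K" for i
    proof -
      have "i \<noteq> j" using that j by auto
      then show ?thesis
        \<comment> \<open>Exactly one of \<open>i < j\<close> and \<open>j < i\<close> holds, so
          interchanging the insertion of \<open>i\<close> with the removal of \<open>j\<close> costs
          exactly one sign.\<close>
        using that by (cases i j rule: linorder_cases)
          (simp_all add: X_def pos_sign_insert pos_sign_remove[OF j] insert_Diff_if less_not_sym)
    qed
    ultimately show ?thesis
      by (simp add: distrib_left sum_distrib_left sum_negf mult_ac)
  qed
  have "(contract m (wedge l v) + wedge l (contract m v)) $ K =
     (\<Sum>i\<in>-K. of_real (m $ i * l $ i) * v $ K + (\<Sum>j\<in>K. X i j)) +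
     (\<Sum>j\<in>K. of_real (m $ j * l $ j) * v $ K - (\<Sum>i\<in>-K. X i j))"
    unfolding vector_add_component contract_def[of m "wedge l v"] wedge_def[of l "contract m v"]
    by (simp add: 1 2)
  also have "\<dots> = (\<Sum>i\<in>-K. of_real (m $ i * l $ i) * v $ K) + (\<Sum>j\<in>K. of_real (m $ j * l $ j) * v $ K)"
    by (simp add: sum.distrib sum_subtractf sum.swap[of X K "- K"])
  also have "\<dots> = (\<Sum>i\<in>UNIV. of_real (m $ i * l $ i) * v $ K)"
    by (subst sum.union_disjoint[symmetric]) (auto simp: Un_commute)
  also have "\<dots> = (of_real (m \<bullet> l) *s v) $ K"
    by (simp add: inner_vec_def sum_distrib_right)
  finally show "(contract m (wedge l v) + wedge l (contract m v)) $ K = (of_real (m \<bullet> l) *s v) $ K" .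
qed

text \<open>The double sum has antisymmetric terms. Setting \<open>X\<close> to zero on the diagonal
  lets both indices range over the same set, so that swapping them is possible.\<close>

lemma contract_contract: "contract m (contract m v) = 0"
proof (rule vec_eq_iff[THEN iffD2], rule allI)
  fix K :: "'a set"
  define X where "X i j = (if i = j then 0 else
     pos_sign i K * pos_sign j (insert i K) * of_real (m $ i) * of_real (m $ j) * v $ insert j (insert i K))" for i j
  have "pos_sign i K * of_real (m $ i) * contract m v $ insert i K = (\<Sum>j\<in>-K. X i j)" if "i \<in> - K" for i
  proof -
    have "(\<Sum>j\<in>-K. X i j) = (\<Sum>j\<in>- insert i K. X i j)"
      using that by (intro sum.mono_neutral_right) (auto simp: X_def)
    also have "\<dots> = (\<Sum>j\<in>- insert i K. pos_sign i K * pos_sign j (insert i K) * of_real (m $ i) * of_real (m $ j) * v $ insert j (insert i K))"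
      by (intro sum.cong) (auto simp: X_def)
    finally show ?thesis by (simp add: contract_def sum_distrib_left mult_ac)
  qed
  then have eq: "contract m (contract m v) $ K = (\<Sum>i\<in>-K. \<Sum>j\<in>-K. X i j)"
    by (simp add: contract_def[of m "contract m v"])
  have "X j i = - X i j" if "i \<in> - K" "j \<in> - K" for i j
    using that by (auto simp: X_def pos_sign_insert insert_commute)
  then have "(\<Sum>i\<in>-K. \<Sum>j\<in>-K. X j i) = (\<Sum>i\<in>-K. \<Sum>j\<in>-K. - X i j)"
    by (intro sum.cong refl)
  also have "\<dots> = - (\<Sum>i\<in>-K. \<Sum>j\<in>-K. X i j)"
    by (simp add: sum_negf)
  finally have "(\<Sum>i\<in>-K. \<Sum>j\<in>-K. X j i) = - (\<Sum>i\<in>-K. \<Sum>j\<in>-K. X i j)" .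
  moreover have "(\<Sum>i\<in>-K. \<Sum>j\<in>-K. X j i) = (\<Sum>i\<in>-K. \<Sum>j\<in>-K. X i j)"
    by (rule sum.swap)
  ultimately show "contract m (contract m v) $ K = 0 $ K" by (simp add: eq)
qed

lemma subspace_kforms: "vec.subspace (kforms k)"
  by (auto simp: kforms_def vec.subspace_def)

text \<open>Choose \<open>j\<close> with \<open>m $ j \<noteq> 0\<close>. The equation at
  \<open>J - {j}\<close> expresses the coefficient at \<open>J\<close> through coefficients at sets
  avoiding \<open>j\<close>, so restriction \<open>R\<close> to those sets is injective on the
  kernel. It is also onto, and the \<open>Suc p\<close>-subsets avoiding \<open>j\<close> are
  counted by the binomial coefficient.\<close>

lemma dim_ker_contract:
  fixes m :: "real^'n::{finite,linorder}"
  assumes "m \<noteq> 0"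
  shows "vec.dim {v \<in> kforms (Suc p). contract m v = 0} = (CARD('n) - 1) choose (Suc p)"
proof -
  interpret c: Vector_Spaces.linear "(*s)" "(*s)" "contract m" by (rule linear_contract)
  let ?S = "{v \<in> kforms (Suc p). contract m v = 0}"
  obtain j where j: "m $ j \<noteq> 0" using assms by (auto simp: vec_eq_iff)
  define R :: "complex^('n set) \<Rightarrow> complex^('n set)" where "R v = (\<chi> J. if j \<in> J then 0 else v $ J)" for v
  have linR: "Vector_Spaces.linear (*s) (*s) R"
    by (intro Vector_Spaces.linear_iff[THEN iffD2] conjI allI vec.vector_space_axioms)
      (simp_all add: R_def vec_eq_iff)
  have sub: "vec.subspace ?S"
    using subspace_kforms[of "Suc p"] by (auto simp: vec.subspace_def c.add c.scale c.zero)
  have inj: "inj_on R ?S"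
  proof (subst vec.linear_inj_on_iff_eq_0[OF linR sub], intro ballI impI)
    fix v assume v: "v \<in> ?S" "R v = 0"
    then have 0: "v $ J = 0" if "j \<notin> J" for J
      proof -
      have "R v $ J = 0" using v(2) by simp
      with that show ?thesis by (simp add: R_def)
    qed
    have "v $ J = 0" if "j \<in> J" for J
    proof -
      have "0 = contract m v $ (J - {j})" using v by simp
      moreover have "- (J - {j}) = insert j (- J)" using that by auto
      ultimately have "0 = pos_sign j (J - {j}) * of_real (m $ j) * v $ J
          + (\<Sum>i\<in>-J. pos_sign i (J - {j}) * of_real (m $ i) * v $ insert i (J - {j}))"
        using that by (simp add: contract_def insert_absorb)
      also have "(\<Sum>i\<in>-J. pos_sign i (J - {j}) * of_real (m $ i) * v $ insert i (J - {j})) = 0"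
        using that by (intro sum.neutral ballI) (auto intro!: 0)
      finally show ?thesis using j by (simp add: pos_sign_def)
    qed
    with 0 show "v = 0" by (metis vec_eq_iff zero_index)
  qed
  have img: "R ` ?S = {v. \<forall>J. J \<notin> {J. J \<subseteq> - {j} \<and> card J = Suc p} \<longrightarrow> v $ J = 0}"
  proof (intro equalityI subsetI)
    fix u assume "u \<in> R ` ?S"
    then show "u \<in> {v. \<forall>J. J \<notin> {J. J \<subseteq> - {j} \<and> card J = Suc p} \<longrightarrow> v $ J = 0}"
      by (auto simp: R_def kforms_def)
  next
    fix u :: "complex^('n set)" assume u: "u \<in> {v. \<forall>J. J \<notin> {J. J \<subseteq> - {j} \<and> card J = Suc p} \<longrightarrow> v $ J = 0}"
    then have uk: "u \<in> kforms (Suc p)" by (auto simp: kforms_def)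
    txt \<open>Subtracting this multiple of the exterior product with the j-th coordinate form only changes
      coefficients at index sets containing j.\<close>
    define w where "w = wedge (axis j 1) (contract m u)"
    define v where "v = u - (1 / of_real (m $ j)) *s w"
    have w: "w \<in> kforms (Suc p)"
      unfolding w_def by (intro wedge_in_kforms contract_in_kforms uk)
    have "contract m w = of_real (m $ j) *s contract m u"
      using contract_wedge[of m "axis j 1" "contract m u"] linear_wedge[of "axis j (1::real)"]
      by (simp add: w_def contract_contract inner_axis vec.linear_0)
    then have "contract m v = 0"
      using j by (simp add: v_def c.diff c.scale)
    moreover have "v \<in> kforms (Suc p)"
      unfolding v_def using uk w
      by (intro vec.subspace_diff vec.subspace_scale subspace_kforms)
    moreover have "w $ J = 0" if "j \<notin> J" for J
      using that by (auto simp: w_def wedge_def axis_def intro!: sum.neutral)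
    then have "R v = u"
      using u by (auto simp: R_def v_def vec_eq_iff)
    ultimately show "u \<in> R ` ?S" by auto
  qed
  have "vec.dim ?S = vec.dim (R ` ?S)"
    using vec.dim_image_eq[OF linR, of ?S] inj sub by (simp add: vec.span_eq_iff[THEN iffD2])
  also have "\<dots> = card {J. J \<subseteq> - {j} \<and> card J = Suc p}"
    unfolding img by (rule dim_substandard_cart)
  also have "\<dots> = (CARD('n) - 1) choose (Suc p)"
    by (subst n_subsets) (simp_all add: card_Diff_singleton Compl_eq_Diff_UNIV)
  finally show ?thesis .
qed

section \<open>The symbol of curl and its eigenspaces\<close>

text \<open>The first scalar is the one from the definition of curl;
  \<open>2 * of_real pi * \<i>\<close> comes from differentiating
  \<open>char_mode m\<close>.\<close>

definition curl_symbol :: "real^'n::{finite,linorder} \<Rightarrow> complex^('n set) \<Rightarrow> complex^('n set)" where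
  "curl_symbol m v = (\<chi> K. if card K = CARD('n) - Suc ((CARD('n) - 1) div 2)
     then (if CARD('n) mod 4 = 1 then \<i> else 1) * (2 * of_real pi * \<i>) * shuffle_sign (UNIV - K) K * wedge m v $ (UNIV - K)
     else 0)"

definition symbol_eigenspace :: "real^'n::{finite,linorder} \<Rightarrow> real \<Rightarrow> (complex^('n set)) set" where
  "symbol_eigenspace m lam = {v \<in> kforms ((CARD('n) - 1) div 2). curl_symbol m v = of_real lam *s v}"

lemma linear_curl_symbol: "Vector_Spaces.linear (*s) (*s) (curl_symbol m)"
proof -
  interpret w: Vector_Spaces.linear "(*s)" "(*s)" "wedge m" by (rule linear_wedge)
  show ?thesis
    by (intro Vector_Spaces.linear_iff[THEN iffD2] conjI allI vec.vector_space_axioms)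
      (auto simp: curl_symbol_def vec_eq_iff w.add w.scale distrib_left mult_ac)
qed

text \<open>Let \<open>M\<close> be the complement of \<open>insert j K\<close>. Each of the
  \<open>k * k\<close> pairs between \<open>K\<close> and \<open>M\<close> is compared once in
  either order and contributes \<open>- 1\<close>, and \<open>k * k\<close> has the parity of
  \<open>k\<close>. The sign of \<open>j\<close> against \<open>M\<close> occurs twice and cancels,
  leaving that of \<open>j\<close> against \<open>K\<close>.\<close>

lemma shuffle_sign_complement:
  fixes K :: "'n::{finite,linorder} set"
  assumes j: "j \<notin> K" and K: "card K = k" and n: "CARD('n) = 2 * k + 1"
  shows "shuffle_sign (UNIV - K) K * pos_sign j (UNIV - K) * shuffle_sign (insert j K) (UNIV - insert j K)
     = (- 1) ^ k * pos_sign j K"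
proof -
  let ?s = "\<lambda>a b :: 'n. if b < a then - 1 else 1 :: complex"
  define M where "M = UNIV - insert j K"
  have UK: "UNIV - K = insert j M" and jM: "j \<notin> M" and disj: "K \<inter> M = {}" using j by (auto simp: M_def)
  have cM: "card M = k"
    using j K n by (simp add: M_def card_Diff_subset)
  have 1: "shuffle_sign (UNIV - K) K = pos_sign j K * (\<Prod>a\<in>K. \<Prod>b\<in>M. ?s b a)"
    unfolding UK shuffle_sign_prod using jM by (simp add: pos_sign_prod prod.swap[of _ M K])
  have 2: "pos_sign j (UNIV - K) = pos_sign j M"
    unfolding UK using jM by (simp add: pos_sign_insert)
  have 3: "shuffle_sign (insert j K) M = pos_sign j M * (\<Prod>a\<in>K. \<Prod>b\<in>M. ?s a b)"
    unfolding shuffle_sign_prod using j by (simp add: pos_sign_prod)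
  have "(\<Prod>a\<in>K. \<Prod>b\<in>M. ?s b a) * (\<Prod>a\<in>K. \<Prod>b\<in>M. ?s a b) = (\<Prod>a\<in>K. \<Prod>b\<in>M. ?s b a * ?s a b)"
    by (simp add: prod.distrib)
  also have "\<dots> = (\<Prod>a\<in>K. \<Prod>b\<in>M. - 1)"
    using disj by (intro prod.cong refl) auto
  also have "\<dots> = (- 1) ^ k"
    by (cases "even k") (simp_all add: K cM)
  finally have 4: "(\<Prod>a\<in>K. \<Prod>b\<in>M. ?s b a) * (\<Prod>a\<in>K. \<Prod>b\<in>M. ?s a b) = (- 1) ^ k" .
  have "shuffle_sign (UNIV - K) K * pos_sign j (UNIV - K) * shuffle_sign (insert j K) M
     = pos_sign j K * (pos_sign j M * pos_sign j M) *
        ((\<Prod>a\<in>K. \<Prod>b\<in>M. ?s b a) * (\<Prod>a\<in>K. \<Prod>b\<in>M. ?s a b))"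
    unfolding 1 2 3 by (simp only: mult_ac)
  then show ?thesis unfolding 4 by (simp add: M_def)
qed

lemma curl_symbol_curl_symbol:
  fixes m :: "real^'n::{finite,linorder}"
  assumes v: "v \<in> kforms k" and n: "CARD('n) = 2 * k + 1"
  shows "curl_symbol m (curl_symbol m v) = of_real (4 * pi\<^sup>2) *s contract m (wedge m v)"
proof (rule vec_eq_iff[THEN iffD2], rule allI)
  fix K :: "'n set"
  define c :: complex where "c = (if CARD('n) mod 4 = 1 then \<i> else 1) * (2 * of_real pi * \<i>)"
  have nk: "CARD('n) - Suc ((CARD('n) - 1) div 2) = k" using n by simp
  have sym: "curl_symbol m u $ J = (if card J = k then c * shuffle_sign (UNIV - J) J * wedge m u $ (UNIV - J) else 0)" for u J
    unfolding curl_symbol_def nk c_def by simp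
  \<comment> \<open>For even \<open>k\<close> the dimension is 1 modulo 4 and \<open>c\<close>
    equals \<open>- 2 * pi\<close>; for odd \<open>k\<close> it is 3 modulo 4 and \<open>c\<close>
    equals \<open>2 * pi * \<i>\<close>, whose negative square is compensated by
    \<open>(- 1) ^ k\<close>.\<close>
  have cc: "c * c * (- 1) ^ k = of_real (4 * pi\<^sup>2)"
  proof (cases "even k")
    case True
    then obtain q where "k = 2 * q" by (elim evenE)
    then have "CARD('n) mod 4 = 1" using n by simp
    then show ?thesis using True by (simp add: c_def power2_eq_square)
  next
    case False
    then obtain q where "k = 2 * q + 1" by (elim oddE)
    then have "CARD('n) = 3 + 4 * q" using n by simp
    then have "CARD('n) mod 4 = 3" by presburger
    then show ?thesis using False by (simp add: c_def power2_eq_square)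
  qed
  show "curl_symbol m (curl_symbol m v) $ K = (of_real (4 * pi\<^sup>2) *s contract m (wedge m v)) $ K"
  proof (cases "card K = k")
    case False
    moreover have "contract m (wedge m v) \<in> kforms k"
      by (intro contract_in_kforms wedge_in_kforms v)
    ultimately show ?thesis by (simp add: sym kforms_def)
  next
    case K: True
    have "c * shuffle_sign (UNIV - K) K * (pos_sign j (UNIV - K) * of_real (m $ j) * curl_symbol m v $ (UNIV - K - {j}))
      = of_real (4 * pi\<^sup>2) * (pos_sign j K * of_real (m $ j) * wedge m v $ insert j K)"
      if j: "j \<in> UNIV - K" for j
    proof -
      have e: "UNIV - K - {j} = UNIV - insert j K" "UNIV - (UNIV - insert j K) = insert j K" by auto
      have "card (UNIV - insert j K) = k" using j K n by (simp add: card_Diff_subset)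
      then have "c * shuffle_sign (UNIV - K) K * (pos_sign j (UNIV - K) * of_real (m $ j) * curl_symbol m v $ (UNIV - K - {j}))
        = c * c * (shuffle_sign (UNIV - K) K * pos_sign j (UNIV - K) * shuffle_sign (insert j K) (UNIV - insert j K))
           * of_real (m $ j) * wedge m v $ insert j K"
        unfolding e(1) sym e(2) by simp
      also have "\<dots> = (c * c * (- 1) ^ k) * (pos_sign j K * of_real (m $ j) * wedge m v $ insert j K)"
        using j by (subst shuffle_sign_complement[OF _ K n]) auto
      finally show ?thesis unfolding cc .
    qed
    then have "(\<Sum>j\<in>UNIV - K. c * shuffle_sign (UNIV - K) K * (pos_sign j (UNIV - K) * of_real (m $ j) * curl_symbol m v $ (UNIV - K - {j})))
      = (\<Sum>j\<in>UNIV - K. of_real (4 * pi\<^sup>2) * (pos_sign j K * of_real (m $ j) * wedge m v $ insert j K))"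
      by (intro sum.cong refl)
    then show ?thesis
      unfolding sym[of "curl_symbol m v"]
      by (simp add: K wedge_def[of m "curl_symbol m v"] contract_def sum_distrib_left Compl_eq_Diff_UNIV)
  qed
qed

text \<open>Contracting the squared eigenvalue equation with \<open>m\<close> kills its left side,
  so \<open>contract m v\<close> vanishes. The anticommutator then turns
  \<open>contract m (wedge m v)\<close> into the squared norm of \<open>m\<close> times
  \<open>v\<close>, which fixes \<open>lam\<close> up to sign.\<close>

lemma symbol_eigenspace_coclosed:
  fixes m :: "real^'n::{finite,linorder}"
  assumes v: "v \<in> symbol_eigenspace m lam" and odd: "odd CARD('n)" and lam: "lam \<noteq> 0"
  shows "contract m v = 0" "v \<noteq> 0 \<Longrightarrow> \<bar>lam\<bar> = 2 * pi * norm m"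
proof -
  interpret s: Vector_Spaces.linear "(*s)" "(*s)" "curl_symbol m" by (rule linear_curl_symbol)
  interpret c: Vector_Spaces.linear "(*s)" "(*s)" "contract m" by (rule linear_contract)
  interpret w: Vector_Spaces.linear "(*s)" "(*s)" "wedge m" by (rule linear_wedge)
  obtain k where k: "CARD('n) = 2 * k + 1" using odd by (elim oddE)
  have vk: "v \<in> kforms k" and ev: "curl_symbol m v = of_real lam *s v"
    using v k by (simp_all add: symbol_eigenspace_def)
  have "curl_symbol m (curl_symbol m v) = of_real (lam\<^sup>2) *s v"
    by (simp add: ev s.scale power2_eq_square)
  then have sq: "of_real (4 * pi\<^sup>2) *s contract m (wedge m v) = of_real (lam\<^sup>2) *s v"
    using curl_symbol_curl_symbol[OF vk k, of m] by simp
  then have "contract m (of_real (4 * pi\<^sup>2) *s contract m (wedge m v)) = contract m (of_real (lam\<^sup>2) *s v)"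
    by simp
  then show co: "contract m v = 0"
    using lam by (simp add: c.scale contract_contract vec.scale_eq_0_iff)
  have "contract m (wedge m v) = of_real ((norm m)\<^sup>2) *s v"
    using contract_wedge[of m m v] by (simp add: co power2_norm_eq_inner)
  with sq have "complex_of_real ((2 * pi * norm m)\<^sup>2) *s v = of_real (lam\<^sup>2) *s v"
    by (simp add: power_mult_distrib)
  moreover assume "v \<noteq> 0"
  ultimately have "(2 * pi * norm m)\<^sup>2 = lam\<^sup>2"
    using vec.scale_cancel_right[of "complex_of_real ((2 * pi * norm m)\<^sup>2)" v "of_real (lam\<^sup>2)"] 
    by (simp only: of_real_eq_iff simp_thms)
  then show "\<bar>lam\<bar> = 2 * pi * norm m"
    by (metis abs_of_nonneg norm_ge_zero pi_ge_zero mult_nonneg_nonneg power2_eq_iff_nonneg zero_le_numeral power2_abs abs_ge_zero)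
qed

lemma subspace_symbol_eigenspace: "vec.subspace (symbol_eigenspace m lam)"
proof -
  interpret s: Vector_Spaces.linear "(*s)" "(*s)" "curl_symbol m" by (rule linear_curl_symbol)
  show ?thesis
    using subspace_kforms
    by (auto simp: vec.subspace_def symbol_eigenspace_def s.add s.scale s.zero vec.scale_right_distrib mult.commute)
qed

lemma symbol_eigenspace_uminus: "symbol_eigenspace (- m) lam = symbol_eigenspace m (- lam)"
proof -
  have "curl_symbol (- m) v = - curl_symbol m v" for v
    by (auto simp: curl_symbol_def wedge_def vec_eq_iff sum_negf)
  then have "curl_symbol (- m) v = of_real lam *s v \<longleftrightarrow> curl_symbol m v = of_real (- lam) *s v" for v
    by (simp add: vec_eq_iff) (metis add.inverse_inverse)
  then show ?thesis by (simp add: symbol_eigenspace_def)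
qed

lemma dim_symbol_eigenspace_pair:
  fixes m :: "real^'n::{finite,linorder}"
  assumes n3: "CARD('n) \<ge> 3" and odd: "odd CARD('n)" and lam: "lam \<noteq> 0" and m: "\<bar>lam\<bar> = 2 * pi * norm m"
  shows "vec.dim (symbol_eigenspace m lam) + vec.dim (symbol_eigenspace (- m) lam) =
     (CARD('n) - 1) choose ((CARD('n) - 1) div 2)"
proof -
  interpret s: Vector_Spaces.linear "(*s)" "(*s)" "curl_symbol m" by (rule linear_curl_symbol)
  let ?A = "symbol_eigenspace m lam" and ?B = "symbol_eigenspace m (- lam)"
  obtain k where k: "CARD('n) = 2 * k + 1" using odd by (elim oddE)
  \<comment> \<open>Dimension at least 3 makes the middle degree positive, as the kernel dimension
    formula demands.\<close>
  then obtain p where p: "k = Suc p" using n3 by (cases k) auto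
  have kk: "(CARD('n) - 1) div 2 = k" using k by simp
  have "m \<noteq> 0" using m lam by auto
  have "?A \<inter> ?B = {0}"
  proof -
    have "v = 0" if "v \<in> ?A" "v \<in> ?B" for v
    proof -
      have "of_real lam *s v = of_real (- lam) *s v"
        using that by (simp add: symbol_eigenspace_def)
      then show ?thesis using lam vec.scale_cancel_right[of "complex_of_real lam" v "of_real (- lam)"]
        by (simp only: of_real_eq_iff) simp
    qed
    then show ?thesis using vec.subspace_0[OF subspace_symbol_eigenspace] by blast
  qed
  moreover have "{x + y |x y. x \<in> ?A \<and> y \<in> ?B} = {v \<in> kforms k. contract m v = 0}"
  proof (intro equalityI subsetI)
    interpret c: Vector_Spaces.linear "(*s)" "(*s)" "contract m" by (rule linear_contract)
    fix v assume "v \<in> {x + y |x y. x \<in> ?A \<and> y \<in> ?B}"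
    then obtain x y where v: "v = x + y" "x \<in> ?A" "y \<in> ?B" by blast
    then have "x \<in> kforms k" "y \<in> kforms k" unfolding symbol_eigenspace_def kk by auto
    with v show "v \<in> {v \<in> kforms k. contract m v = 0}"
      using symbol_eigenspace_coclosed(1)[OF v(2) odd lam] symbol_eigenspace_coclosed(1)[OF v(3) odd] lam
      by (simp add: c.add vec.subspace_add[OF subspace_kforms])
  next
    fix v assume v: "v \<in> {v \<in> kforms k. contract m v = 0}"
    \<comment> \<open>On the kernel of the contraction the symbol exchanges \<open>v\<close> and
      \<open>u\<close> up to the factor \<open>lam\<close>, so half their sum and half their
      difference are eigenvectors for \<open>lam\<close> and \<open>- lam\<close>.\<close>
    define u where "u = (1 / of_real lam) *s curl_symbol m v"
    have uk: "u \<in> kforms k" by (simp add: u_def kforms_def curl_symbol_def k)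
    have "contract m (wedge m v) = of_real ((norm m)\<^sup>2) *s v"
      using contract_wedge[of m m v] v linear_wedge[of m] by (simp add: vec.linear_0 power2_norm_eq_inner)
    moreover have "4 * pi\<^sup>2 * (norm m)\<^sup>2 = lam\<^sup>2"
      using m by (metis power2_abs power_mult_distrib four_x_squared mult.assoc)
    ultimately have "curl_symbol m (curl_symbol m v) = of_real (lam\<^sup>2) *s v"
      using curl_symbol_curl_symbol[OF _ k, of v m] v
      by (simp del: of_real_power of_real_mult add: of_real_mult[symmetric])
    then have su: "curl_symbol m u = of_real lam *s v"
      using lam by (simp add: u_def s.scale power2_eq_square)
    have sv: "curl_symbol m v = of_real lam *s u" using lam by (simp add: u_def)
    have "(1/2) *s (v + u) \<in> ?A"
      using v uk unfolding symbol_eigenspace_def kk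
      by (auto intro!: vec.subspace_scale vec.subspace_add subspace_kforms
          simp: s.scale s.add su sv vec.scale_right_distrib add.commute mult.commute)
    moreover have "(1/2) *s (v - u) \<in> ?B"
      using v uk unfolding symbol_eigenspace_def kk
      by (auto intro!: vec.subspace_scale vec.subspace_diff subspace_kforms
          simp: s.scale s.diff su sv vec.scale_right_diff_distrib mult.commute)
    moreover have "v = (1/2) *s (v + u) + (1/2) *s (v - u)"
      by (simp add: vec_eq_iff field_simps)
    ultimately show "v \<in> {x + y |x y. x \<in> ?A \<and> y \<in> ?B}" by blast
  qed
  ultimately show ?thesis
    using vec.dim_sums_Int[OF subspace_symbol_eigenspace[of m lam] subspace_symbol_eigenspace[of m "- lam"]]
      dim_ker_contract[OF \<open>m \<noteq> 0\<close>, of p]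
    unfolding symbol_eigenspace_uminus kk p by simp
qed

section \<open>Eigenforms of curl\<close>

interpretation form: vector_space form_scale
  by unfold_locales (simp_all add: form_scale_def fun_eq_iff algebra_simps)

lemma sum_fun_apply2: "(\<Sum>i\<in>I. f i) x = (\<Sum>i\<in>I. f i x)"
  for f :: "'i \<Rightarrow> 'a \<Rightarrow> 'b::comm_monoid_add"
  by (induction I rule: infinite_finite_induct) auto

definition mode_form :: "real^'n \<Rightarrow> complex^('n set) \<Rightarrow> 'n::finite form" where
  "mode_form m v = (\<lambda>J x. v $ J * char_mode m x)"

lemma mode_form_add: "mode_form m (u + v) = mode_form m u + mode_form m v"
  by (simp add: mode_form_def fun_eq_iff algebra_simps)

lemma mode_form_scale: "mode_form m (c *s v) = form_scale c (mode_form m v)"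
  by (simp add: mode_form_def form_scale_def fun_eq_iff)

lemma mode_form_0 [simp]: "mode_form m 0 = 0"
  by (simp add: mode_form_def fun_eq_iff)

lemma mode_form_sum: "mode_form m (\<Sum>i\<in>I. f i) = (\<Sum>i\<in>I. mode_form m (f i))"
  by (induction I rule: infinite_finite_induct) (auto simp: mode_form_add)

text \<open>The prefactor \<open>a\<close> gives the derivative the same shape as the function, so
  that iterated partial derivatives stay within multiples of one character.\<close>

lemma has_vector_derivative_char_mode:
  fixes m :: "real^'n"
  shows "((\<lambda>t. a * char_mode m (x + t *\<^sub>R axis i 1)) has_vector_derivative
     (a * (2 * of_real pi * \<i> * of_real (m $ i))) * char_mode m x) (at 0)"
proof -
  define c where "c = 2 * of_real pi * \<i> * of_real (m $ i)"
  have "((\<lambda>t. a * char_mode m x * exp (c * of_real t)) has_vector_derivative a * char_mode m x * c) (at 0)"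
    by (rule has_vector_derivative_real_field) (auto intro!: derivative_eq_intros)
  moreover have "a * char_mode m x * exp (c * of_real t) = a * char_mode m (x + t *\<^sub>R axis i 1)" for t
    by (simp add: char_mode_add) (simp add: char_mode_def c_def cis_conv_exp inner_axis mult_ac)
  ultimately have "((\<lambda>t. a * char_mode m (x + t *\<^sub>R axis i 1)) has_vector_derivative a * char_mode m x * c) (at 0)"
    by (simp only:)
  then show ?thesis by (simp add: c_def mult_ac)
qed

lemma partial_char_mode:
  "partial i (\<lambda>x. a * char_mode m x) = (\<lambda>x. (a * (2 * of_real pi * \<i> * of_real (m $ i))) * char_mode m x)"
  unfolding partial_def by (intro ext vector_derivative_at has_vector_derivative_char_mode)

lemma iter_partial_char_mode:
  "\<exists>a'. iter_partial is (\<lambda>x. a * char_mode m x) = (\<lambda>x. a' * char_mode m x)"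
  by (induction "is") (auto simp: partial_char_mode)

lemma smooth_fun_char_mode: "smooth_fun (\<lambda>x. a * char_mode m x)"
  unfolding smooth_fun_def
proof (intro allI conjI)
  fix "is" :: "'a list" and x :: "real^'a" and i :: 'a
  obtain a' where a': "iter_partial is (\<lambda>x. a * char_mode m x) = (\<lambda>x. a' * char_mode m x)"
    using iter_partial_char_mode by blast
  show "continuous_on UNIV (iter_partial is (\<lambda>x. a * char_mode m x))"
    unfolding a' by (intro continuous_intros)
  show "(\<lambda>t. iter_partial is (\<lambda>x. a * char_mode m x) (x + t *\<^sub>R axis i 1)) differentiable at 0"
    unfolding a' by (rule differentiableI_vector[OF has_vector_derivative_char_mode])
qed

lemma char_mode_periodic:
  assumes "m \<bullet> g \<in> \<int>"
  shows "char_mode m (x + g) = char_mode m x"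
  using assms unfolding char_mode_add by (simp add: char_mode_def)

lemma curl_apply:
  fixes w :: "'n::{finite,linorder} form"
  shows "curl w K x = (if card K = CARD('n) - Suc ((CARD('n) - 1) div 2)
     then (if CARD('n) mod 4 = 1 then \<i> else 1) * (shuffle_sign (UNIV - K) K *
        (\<Sum>j\<in>UNIV - K. pos_sign j (UNIV - K) * partial j (w (UNIV - K - {j})) x))
     else 0)"
proof -
  have "Suc ((CARD('n) - 1) div 2) \<le> CARD('n)"
    using zero_less_card_finite[where 'a='n] by linarith
  then have "card K = CARD('n) - Suc ((CARD('n) - 1) div 2) \<Longrightarrow> card (UNIV - K) = Suc ((CARD('n) - 1) div 2)"
    by (simp add: card_Diff_subset)
  then show ?thesis
    by (simp add: curl_def Let_def hodge_def ext_d_def pos_sign_def)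
qed

lemma curl_mode_form: "curl (mode_form m v) = mode_form m (curl_symbol m v)"
  unfolding fun_eq_iff curl_apply mode_form_def partial_char_mode
  by (simp add: curl_symbol_def wedge_def sum_distrib_left sum_distrib_right mult_ac)

lemma mode_form_in_curl_eigenspace:
  fixes m :: "real^'n::{finite,linorder}"
  assumes "m \<in> dual_lattice L" "v \<in> symbol_eigenspace m lam"
  shows "mode_form m v \<in> curl_eigenspace L (complex_of_real lam)"
proof -
  have "curl (mode_form m v) = form_scale lam (mode_form m v)"
    using assms(2) by (simp add: curl_mode_form symbol_eigenspace_def mode_form_scale)
  moreover have "periodic_on_lattice L (\<lambda>x. c * char_mode m x)" for c
    using assms(1) by (simp add: periodic_on_lattice_def dual_lattice_def char_mode_periodic)
  then have "mode_form m v \<in> smooth_forms L ((CARD('n) - 1) div 2)"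
    using assms(2) unfolding smooth_forms_def mode_form_def symbol_eigenspace_def kforms_def
    by (auto simp: smooth_fun_char_mode)
  ultimately show ?thesis by (simp add: curl_eigenspace_def)
qed

lemma smooth_has_deriv_along:
  assumes "smooth_fun f"
  shows "has_deriv_along (axis i 1) f (partial i f)"
proof -
  have "continuous_on UNIV f" "continuous_on UNIV (partial i f)"
    and "(\<lambda>t. f (x + t *\<^sub>R axis i 1)) differentiable (at 0)" for x
    using assms[unfolded smooth_fun_def, THEN spec, of "[]"] assms[unfolded smooth_fun_def, THEN spec, of "[i]"]
    by auto
  then show ?thesis
    unfolding has_deriv_along_def partial_def[abs_def] vector_derivative_works by blast
qed

section \<open>Lattice bases and the dual lattice\<close>

text \<open>The last clause lets any prescribed frequencies be realised by a vector. Integer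
  frequencies thereby come from dual vectors, which links \<open>proj_mode_uniqueness\<close> to the
  dual lattice.\<close>

definition is_lattice_basis :: "(real^'n) list \<Rightarrow> (real^'n) set \<Rightarrow> bool" where
  "is_lattice_basis bs L \<longleftrightarrow> distinct bs \<and> span (set bs) = UNIV \<and> set bs \<subseteq> L
     \<and> dual_lattice L = {m. \<forall>b\<in>set bs. m \<bullet> b \<in> \<int>} \<and> (\<forall>k. \<exists>l. \<forall>b\<in>set bs. l \<bullet> b = k b)"

lemma lattice_basis_exists:
  assumes "is_lattice L"
  shows "\<exists>bs. is_lattice_basis bs L"
proof -
  obtain B where B: "independent B" "span B = UNIV"
    and L: "L = {x. \<exists>c :: real^'a \<Rightarrow> int. x = (\<Sum>b\<in>B. of_int (c b) *\<^sub>R b)}"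
    using assms unfolding is_lattice_def by blast
  have fin: "finite B" using B(1) by (rule finiteI_independent)
  obtain bs where bs: "set bs = B" "distinct bs" using finite_distinct_list[OF fin] by blast
  have BL: "B \<subseteq> L"
  proof
    fix b assume b: "b \<in> B"
    have "b = (\<Sum>a\<in>B. of_int (if a = b then 1 else 0) *\<^sub>R a)"
    proof -
      have "(\<Sum>a\<in>B. of_int (if a = b then 1 else 0) *\<^sub>R a) = (\<Sum>a\<in>B. if a = b then b else 0)"
        by (intro sum.cong) auto
      then show ?thesis using b fin by simp
    qed
    then show "b \<in> L" unfolding L by (intro CollectI exI)
  qed
  have "dual_lattice L = {m. \<forall>b\<in>set bs. m \<bullet> b \<in> \<int>}"
    unfolding bs dual_lattice_def
  proof (intro equalityI subsetI CollectI)
    fix m assume "m \<in> {g. \<forall>m\<in>L. g \<bullet> m \<in> \<int>}"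
    then show "\<forall>b\<in>B. m \<bullet> b \<in> \<int>" using BL by blast
  next
    fix m assume "m \<in> {m. \<forall>b\<in>B. m \<bullet> b \<in> \<int>}"
    then show "\<forall>x\<in>L. m \<bullet> x \<in> \<int>"
      by (auto simp: L inner_sum_right intro!: Ints_sum)
  qed
  moreover have "\<exists>l. \<forall>b\<in>set bs. l \<bullet> b = k b" for k
  proof -
    \<comment> \<open>Values on an independent set extend to a linear functional, and
      \<open>adjoint g 1\<close> is the vector representing it.\<close>
    obtain g :: "real^'a \<Rightarrow> real" where g: "linear g" "\<And>b. b \<in> B \<Longrightarrow> g b = k b"
      using linear_independent_extend[OF B(1), of k] by blast
    have "adjoint g 1 \<bullet> b = g b" for b
      using adjoint_works[OF g(1), of b 1] by (simp add: inner_commute)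
    then have "\<forall>b\<in>set bs. adjoint g 1 \<bullet> b = k b" using g(2) bs(1) by simp
    then show ?thesis by (rule exI)
  qed
  ultimately show ?thesis using bs B BL unfolding is_lattice_basis_def by blast
qed

text \<open>A dual vector is determined by its integer inner products with the basis, and
  Cauchy-Schwarz bounds these once the norm is fixed.\<close>

lemma finite_dual_sphere:
  assumes "is_lattice_basis bs L"
  shows "finite {m \<in> dual_lattice L. norm m = r}"
proof -
  let ?D = "{m \<in> dual_lattice L. norm m = r}"
  \<comment> \<open>The inserted zero vector keeps the maximum over a nonempty set, and
    \<open>\<bar>r\<bar>\<close> avoids a sign condition on \<open>r\<close>.\<close>
  define N where "N = (MAX b\<in>insert 0 (set bs). \<lceil>\<bar>r\<bar> * norm b\<rceil>)"
  define F where "F m = restrict (\<lambda>b. \<lfloor>m \<bullet> b\<rfloor>) (set bs)" for m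
  have dual: "m \<bullet> b \<in> \<int>" if "m \<in> dual_lattice L" "b \<in> set bs" for m b
    using assms that unfolding is_lattice_basis_def by blast
  have "F ` ?D \<subseteq> (\<Pi>\<^sub>E b\<in>set bs. {-N..N})"
  proof clarify
    fix m assume m: "m \<in> dual_lattice L" "r = norm m"
    have "\<lfloor>m \<bullet> b\<rfloor> \<in> {-N..N}" if b: "b \<in> set bs" for b
    proof -
      obtain z where z: "m \<bullet> b = of_int z" using dual[OF m(1) b] by (elim Ints_cases)
      have "\<bar>m \<bullet> b\<bar> \<le> norm m * norm b" by (rule Cauchy_Schwarz_ineq2)
      also have "\<dots> \<le> of_int \<lceil>\<bar>r\<bar> * norm b\<rceil>" using m(2) by simp
      also have "\<dots> \<le> of_int N"
        unfolding N_def using b by (intro of_int_le_iff[THEN iffD2] Max_ge) auto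
      finally have "\<bar>z\<bar> \<le> N" by (simp add: z)
      then show ?thesis by (auto simp: z)
    qed
    then show "F m \<in> (\<Pi>\<^sub>E b\<in>set bs. {-N..N})" by (auto simp: F_def)
  qed
  then have "finite (F ` ?D)" by (rule finite_subset) (intro finite_PiE, auto)
  moreover have "inj_on F ?D"
  proof (intro inj_onI)
    fix m l assume m: "m \<in> ?D" and l: "l \<in> ?D" and eq: "F m = F l"
    have "orthogonal (m - l) b" if b: "b \<in> set bs" for b
    proof -
      have "\<lfloor>m \<bullet> b\<rfloor> = \<lfloor>l \<bullet> b\<rfloor>" using fun_cong[OF eq, of b] b by (simp add: F_def)
      moreover have "m \<bullet> b \<in> \<int>" "l \<bullet> b \<in> \<int>" using m l b dual by auto
      ultimately have "m \<bullet> b = l \<bullet> b" by (metis floor_of_int Ints_cases)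
      then show ?thesis by (simp add: orthogonal_def inner_diff_left)
    qed
    moreover have "m - l \<in> span (set bs)" using assms by (simp add: is_lattice_basis_def)
    ultimately have "orthogonal (m - l) (m - l)" by (meson orthogonal_to_span)
    then show "m = l" by (simp add: orthogonal_self)
  qed
  ultimately show ?thesis by (rule finite_imageD)
qed

section \<open>Fourier coefficients of eigenforms\<close>

text \<open>For periodic coefficients and dual \<open>m\<close>, evaluation at 0 loses nothing: the
  projection is its value there times \<open>char_mode m\<close>.\<close>

definition fourier_coeff :: "(real^'n) list \<Rightarrow> 'n::finite form \<Rightarrow> real^'n \<Rightarrow> complex^('n set)" where
  "fourier_coeff bs w m = (\<chi> J. proj_mode bs (inner m) (w J) 0)"

text \<open>The projected function is differentiated in two ways, under the averages and as an
  explicit multiple of a character; uniqueness of derivatives equates the results.\<close>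

lemma proj_mode_partial:
  fixes f :: "real^'n::finite \<Rightarrow> complex"
  assumes f: "smooth_fun f" and per: "periodic_on_lattice L f"
    and bs: "is_lattice_basis bs L" and m: "m \<in> dual_lattice L"
  shows "proj_mode bs (inner m) (partial j f) 0 =
     (2 * of_real pi * \<i> * of_real (m $ j)) * proj_mode bs (inner m) f 0"
proof -
  let ?p = "proj_mode bs (inner m)"
  note d = smooth_has_deriv_along[OF f, of j]
  have cont: "continuous_on UNIV f" using d by (simp add: has_deriv_along_def)
  have eq: "?p f = (\<lambda>x. ?p f 0 * char_mode m x)"
  proof
    fix x
    show "?p f x = ?p f 0 * char_mode m x"
      using bs m per cont
      by (subst proj_mode_eq_char_mode[of f bs m x])
        (auto simp: is_lattice_basis_def periodic_on_lattice_def)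
  qed
  have "((\<lambda>t. ?p f (0 + t *\<^sub>R axis j 1)) has_vector_derivative ?p (partial j f) 0) (at 0)"
    using has_deriv_along_proj_mode[OF d, of bs "inner m"] unfolding has_deriv_along_def by blast
  moreover have "((\<lambda>t. ?p f (0 + t *\<^sub>R axis j 1)) has_vector_derivative
      ?p f 0 * (2 * of_real pi * \<i> * of_real (m $ j)) * char_mode m 0) (at 0)"
    by (subst eq) (rule has_vector_derivative_char_mode)
  ultimately have "?p (partial j f) 0 = ?p f 0 * (2 * of_real pi * \<i> * of_real (m $ j)) * char_mode m 0"
    by (rule vector_derivative_unique_at)
  then show ?thesis by simp
qed

lemma proj_mode_zero: "proj_mode bs k (\<lambda>_. 0) = (\<lambda>_. 0)"
  using proj_mode_scale[of bs k 0 "\<lambda>_. 0"] by simp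

lemma fourier_coeff_eigen:
  fixes w :: "'n::{finite,linorder} form"
  assumes w: "w \<in> curl_eigenspace L (complex_of_real lam)"
    and bs: "is_lattice_basis bs L" and m: "m \<in> dual_lattice L"
  shows "fourier_coeff bs w m \<in> symbol_eigenspace m lam"
proof -
  let ?p = "proj_mode bs (inner m)"
  define k where "k = (CARD('n) - 1) div 2"
  have sm: "smooth_fun (w J)" and per: "periodic_on_lattice L (w J)"
    and deg: "card J \<noteq> k \<Longrightarrow> w J = (\<lambda>_. 0)" and ev: "curl w = form_scale lam w" for J
    using w by (auto simp: curl_eigenspace_def smooth_forms_def k_def)
  have cp: "continuous_on UNIV (partial j (w J))" for j J
    using smooth_has_deriv_along[OF sm, of j J] by (simp add: has_deriv_along_def)
  have "curl_symbol m (fourier_coeff bs w m) $ K = (of_real lam *s fourier_coeff bs w m) $ K" for K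
  proof -
    have "?p (curl w K) 0 = curl_symbol m (fourier_coeff bs w m) $ K"
    proof (cases "card K = CARD('n) - Suc k")
      case True
      define c where "c = (if CARD('n) mod 4 = 1 then \<i> else 1) * shuffle_sign (UNIV - K) K"
      have "curl w K = (\<lambda>x. c * (\<Sum>j\<in>UNIV - K. pos_sign j (UNIV - K) * partial j (w (UNIV - K - {j})) x))"
        using True by (auto simp: curl_apply k_def c_def)
      then have "?p (curl w K) 0 = c * (\<Sum>j\<in>UNIV - K. pos_sign j (UNIV - K) * ?p (partial j (w (UNIV - K - {j}))) 0)"
        by (simp add: proj_mode_scale proj_mode_sum continuous_on_mult cp)
      also have "\<dots> = curl_symbol m (fourier_coeff bs w m) $ K"
        using True unfolding curl_symbol_def k_def[symmetric]
        by (simp add: proj_mode_partial[OF sm per bs m] c_def wedge_def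
            fourier_coeff_def sum_distrib_left mult_ac)
      finally show ?thesis .
    next
      case False
      then have "curl w K = (\<lambda>_. 0)" by (auto simp: curl_apply k_def)
      with False show ?thesis by (simp add: proj_mode_zero curl_symbol_def k_def)
    qed
    moreover have "?p (curl w K) 0 = of_real lam * ?p (w K) 0"
      unfolding ev form_scale_def proj_mode_scale ..
    ultimately show ?thesis by (simp add: fourier_coeff_def)
  qed
  then have "curl_symbol m (fourier_coeff bs w m) = of_real lam *s fourier_coeff bs w m"
    by (simp add: vec_eq_iff)
  moreover have "fourier_coeff bs w m \<in> kforms k"
    by (simp add: kforms_def fourier_coeff_def deg proj_mode_zero)
  ultimately show ?thesis by (simp add: symbol_eigenspace_def k_def)
qed

lemma proj_mode_sum_modes:
  assumes bs: "is_lattice_basis bs L" and D: "D \<subseteq> dual_lattice L" "finite D" and l: "l \<in> dual_lattice L"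
  shows "proj_mode bs (inner l) (\<lambda>x. \<Sum>m\<in>D. a m * char_mode m x)
     = (\<lambda>x. if l \<in> D then a l * char_mode l x else 0)"
proof
  fix x
  have "proj_mode bs (inner l) (char_mode m) = (\<lambda>x. (if m = l then 1 else 0) * char_mode m x)" if "m \<in> D" for m
    using bs D l that by (intro proj_mode_char_mode) (auto simp: is_lattice_basis_def)
  then have "proj_mode bs (inner l) (\<lambda>x. \<Sum>m\<in>D. a m * char_mode m x) x
     = (\<Sum>m\<in>D. if m = l then a l * char_mode l x else 0)"
    by (subst proj_mode_sum) (auto intro!: continuous_intros sum.cong simp: proj_mode_scale)
  then show "proj_mode bs (inner l) (\<lambda>x. \<Sum>m\<in>D. a m * char_mode m x) x
      = (if l \<in> D then a l * char_mode l x else 0)"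
    using D(2) by simp
qed

text \<open>Distinct characters are independent: projecting the relation onto \<open>l\<close>
  isolates its \<open>l\<close> term.\<close>

lemma sum_mode_form_eq_0:
  assumes bs: "is_lattice_basis bs L" and D: "D \<subseteq> dual_lattice L" "finite D"
    and 0: "(\<Sum>m\<in>D. mode_form m (u m)) = 0" and l: "l \<in> D"
  shows "u l = 0"
proof (rule vec_eq_iff[THEN iffD2], rule allI)
  fix J
  have "(\<lambda>x. \<Sum>m\<in>D. u m $ J * char_mode m x) = (\<Sum>m\<in>D. mode_form m (u m)) J"
    by (auto simp: sum_fun_apply2 mode_form_def)
  also have "\<dots> = (\<lambda>_. 0)" unfolding 0 by auto
  finally have "(\<lambda>x. \<Sum>m\<in>D. u m $ J * char_mode m x) = (\<lambda>_. 0)" .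
  then have "(\<lambda>x. if l \<in> D then u l $ J * char_mode l x else 0) = (\<lambda>_. 0)"
    using proj_mode_sum_modes[OF bs D, of l "\<lambda>m. u m $ J"] l D by (auto simp: proj_mode_zero)
  from fun_cong[OF this, of 0] l show "u l $ J = 0 $ J" by simp
qed

text \<open>Inside \<open>D\<close> the finite sum reproduces the coefficients of \<open>w\<close>;
  outside \<open>D\<close> those of \<open>w\<close> vanish, since a nonzero one would be a symbol
  eigenvector forcing the length of its dual vector. Uniqueness then gives equality.\<close>

lemma curl_eigenform_decomposition:
  fixes w :: "'n::{finite,linorder} form"
  assumes w: "w \<in> curl_eigenspace L (complex_of_real lam)" and odd: "odd CARD('n)" and lam: "lam \<noteq> 0"
    and bs: "is_lattice_basis bs L"
  defines "D \<equiv> {m \<in> dual_lattice L. norm m = \<bar>lam\<bar> / (2 * pi)}"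
  shows "w = (\<Sum>m\<in>D. mode_form m (fourier_coeff bs w m))"
proof
  fix J
  have sm: "smooth_fun (w J)" and per: "periodic_on_lattice L (w J)"
    using w by (auto simp: curl_eigenspace_def smooth_forms_def)
  have cont: "continuous_on UNIV (w J)"
    using smooth_has_deriv_along[OF sm] by (simp add: has_deriv_along_def)
  have fin: "finite D" unfolding D_def by (rule finite_dual_sphere[OF bs])
  have D: "D \<subseteq> dual_lattice L" by (auto simp: D_def)
  define s where "s x = (\<Sum>m\<in>D. fourier_coeff bs w m $ J * char_mode m x)" for x
  have conts: "continuous_on UNIV s" unfolding s_def[abs_def] by (intro continuous_intros)
  have perb: "w J (x + b) = w J x" if "b \<in> set bs" for x b
    using per bs that by (auto simp: is_lattice_basis_def periodic_on_lattice_def)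
  \<comment> \<open>The difference is written as a sum with a scalar multiple so that
    \<open>proj_mode_add\<close> and \<open>proj_mode_scale\<close> apply.\<close>
  have "(\<lambda>x. w J x + (- 1) * s x) = (\<lambda>_. 0)"
  proof (rule proj_mode_uniqueness)
    show "continuous_on UNIV (\<lambda>x. w J x + (- 1) * s x)" by (intro continuous_intros cont conts)
    show "w J (x + b) + - 1 * s (x + b) = w J x + - 1 * s x" if "b \<in> set bs" for b x
    proof -
      have "char_mode m (x + b) = char_mode m x" if "m \<in> D" for m
        using that \<open>b \<in> set bs\<close> D bs by (intro char_mode_periodic) (auto simp: is_lattice_basis_def)
      then show ?thesis using that perb by (simp add: s_def)
    qed
    show "distinct bs" using bs by (simp add: is_lattice_basis_def)
    fix k :: "(real, 'n) vec \<Rightarrow> real" assume k: "\<And>b. k b \<in> \<int>"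
    obtain l where l: "\<And>b. b \<in> set bs \<Longrightarrow> l \<bullet> b = k b"
      using bs unfolding is_lattice_basis_def by blast
    then have ld: "l \<in> dual_lattice L" using bs k by (auto simp: is_lattice_basis_def)
    have "proj_mode bs (inner l) (w J) x = char_mode l x * fourier_coeff bs w l $ J" for x
      using bs ld cont perb
      by (subst proj_mode_eq_char_mode[of "w J" bs l x]) (auto simp: is_lattice_basis_def fourier_coeff_def)
    moreover have "proj_mode bs (inner l) s x = (if l \<in> D then fourier_coeff bs w l $ J * char_mode l x else 0)" for x
      unfolding s_def[abs_def] proj_mode_sum_modes[OF bs D fin ld] ..
    moreover have "fourier_coeff bs w l = 0" if "l \<notin> D"
      using symbol_eigenspace_coclosed(2)[OF fourier_coeff_eigen[OF w bs ld] odd lam] that ld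
      by (auto simp: D_def field_simps)
    moreover have "proj_mode bs (inner l) (\<lambda>x. w J x + (- 1) * s x)
        = (\<lambda>x. proj_mode bs (inner l) (w J) x + (- 1) * proj_mode bs (inner l) s x)"
      using proj_mode_add[of "w J" "\<lambda>x. (- 1) * s x" bs "inner l"] cont conts
      unfolding proj_mode_scale by (auto intro!: continuous_intros)
    ultimately have "proj_mode bs (inner l) (\<lambda>x. w J x + (- 1) * s x) = (\<lambda>_. 0)"
      by auto
    then show "proj_mode bs k (\<lambda>x. w J x + (- 1) * s x) = (\<lambda>_. 0)"
      using proj_mode_cong[of bs "inner l" k] l by simp
  qed
  then have "w J x + (- 1) * s x = 0" for x by (rule fun_cong)
  then show "w J = (\<Sum>m\<in>D. mode_form m (fourier_coeff bs w m)) J"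
    by (auto simp: sum_fun_apply2 mode_form_def s_def fun_eq_iff)
qed

section \<open>Multiplicities and the final count\<close>

text \<open>The ambient space of forms is infinite-dimensional, so the dimension is read off an
  explicit basis: the modes built from chosen bases \<open>B m\<close> of the finitely many symbol
  eigenspaces.\<close>

lemma curl_mult_eq_sum:
  fixes L :: "(real^'n::{finite,linorder}) set"
  assumes odd: "odd CARD('n)" and lam: "lam \<noteq> 0" and L: "is_lattice L"
  defines "D \<equiv> {m \<in> dual_lattice L. norm m = \<bar>lam\<bar> / (2 * pi)}"
  shows "curl_mult L (complex_of_real lam) = (\<Sum>m\<in>D. vec.dim (symbol_eigenspace m lam))"
proof -
  obtain bs where bs: "is_lattice_basis bs L" using lattice_basis_exists[OF L] by blast
  have fin: "finite D" unfolding D_def by (rule finite_dual_sphere[OF bs])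
  have D: "D \<subseteq> dual_lattice L" by (auto simp: D_def)
  let ?E = "\<lambda>m :: (real, 'n) vec. symbol_eigenspace m lam"
  have "\<exists>B. B \<subseteq> ?E m \<and> vec.independent B \<and> ?E m \<subseteq> vec.span B \<and> card B = vec.dim (?E m)" for m :: "(real, 'n) vec"
    using vec.basis_exists[of "?E m"] by metis
  then obtain B where B: "\<And>m. B m \<subseteq> ?E m" "\<And>m. vec.independent (B m)" "\<And>m. ?E m \<subseteq> vec.span (B m)"
      "\<And>m. card (B m) = vec.dim (?E m)" by metis
  have finB: "finite (B m)" for m using B(2) by (rule vec.finiteI_independent)
  let ?G = "\<lambda>(m, v). mode_form m v"
  let ?S = "Sigma D B"
  have inj: "inj_on ?G ?S"
  proof (intro inj_onI, clarify)
    fix m v m' v'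
    assume m: "m \<in> D" "m' \<in> D" and v: "v \<in> B m" "v' \<in> B m'" and eq: "mode_form m v = mode_form m' v'"
    have "m = m'"
    proof (rule ccontr)
      assume ne: "m \<noteq> m'"
      \<comment> \<open>Equal modes at different frequencies give a vanishing two-term sum, whose
        terms must be zero separately; but a basis vector \<open>v\<close> is nonzero.\<close>
      define u where "u l = (if l = m then v else - v')" for l
      have "mode_form m' (- v') = - mode_form m' v'" by (simp add: mode_form_def fun_eq_iff)
      then have "(\<Sum>l\<in>{m, m'}. mode_form l (u l)) = 0" using ne eq by (simp add: u_def)
      then have "u m = 0" by (rule sum_mode_form_eq_0[OF bs, rotated 2]) (use m D in auto)
      then show False using v(1) B(2)[of m] vec.dependent_zero by (auto simp: u_def)
    qed
    moreover have "v $ J = v' $ J" for J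
      using fun_cong[OF fun_cong[OF eq, of J], of 0] by (simp add: mode_form_def)
    ultimately show "m = m' \<and> v = v'" by (simp add: vec_eq_iff)
  qed
  have "card (?G ` ?S) = form.dim (curl_eigenspace L (complex_of_real lam))"
  proof (rule form.basis_card_eq_dim)
    show "?G ` ?S \<subseteq> curl_eigenspace L (complex_of_real lam)"
    proof clarify
      fix m v assume "m \<in> D" "v \<in> B m"
      then show "mode_form m v \<in> curl_eigenspace L (complex_of_real lam)"
        using B(1) D by (intro mode_form_in_curl_eigenspace) auto
    qed
    have modes: "mode_form m v \<in> form.span (?G ` ?S)" if m: "m \<in> D" and v: "v \<in> vec.span (B m)" for m v
      using v
    proof (induction rule: vec.span_induct_alt)
      case (step c b y)
      have "mode_form m b \<in> ?G ` ?S" using m step.hyps by force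
      then show ?case
        unfolding mode_form_add mode_form_scale
        by (intro form.span_add form.span_scale form.span_base step.IH)
    qed (simp only: mode_form_0 form.span_zero)
    show "curl_eigenspace L (complex_of_real lam) \<subseteq> form.span (?G ` ?S)"
    proof
      fix w assume w: "w \<in> curl_eigenspace L (complex_of_real lam)"
      have "(\<Sum>m\<in>D. mode_form m (fourier_coeff bs w m)) \<in> form.span (?G ` ?S)"
        using fourier_coeff_eigen[OF w bs] B(3) D by (intro form.span_sum modes) auto
      then show "w \<in> form.span (?G ` ?S)"
        using curl_eigenform_decomposition[OF w odd lam bs] by (simp add: D_def)
    qed
    show "form.independent (?G ` ?S)"
    proof (rule form.independent_if_scalars_zero)
      show "finite (?G ` ?S)" using fin finB by auto
      fix f x assume 0: "(\<Sum>x\<in>?G ` ?S. form_scale (f x) x) = 0" and x: "x \<in> ?G ` ?S"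
      \<comment> \<open>Grouping a relation by frequency makes each \<open>u m\<close> zero through
        independence of characters, after which independence of \<open>B m\<close> kills the
        scalars.\<close>
      define u where "u m = (\<Sum>v\<in>B m. f (mode_form m v) *s v)" for m
      have "(\<Sum>m\<in>D. mode_form m (u m)) = (\<Sum>m\<in>D. \<Sum>v\<in>B m. form_scale (f (mode_form m v)) (mode_form m v))"
        by (simp add: u_def mode_form_sum mode_form_scale)
      also have "\<dots> = (\<Sum>p\<in>?S. form_scale (f (?G p)) (?G p))"
        using fin finB by (subst sum.Sigma) (auto simp: case_prod_unfold)
      also have "\<dots> = (\<Sum>x\<in>?G ` ?S. form_scale (f x) x)"
        by (simp only: sum.reindex[OF inj] o_def)
      finally have "(\<Sum>m\<in>D. mode_form m (u m)) = 0" unfolding 0 .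
      then have u0: "u m = 0" if "m \<in> D" for m by (rule sum_mode_form_eq_0[OF bs D fin _ that])
      obtain m v where mv: "m \<in> D" "v \<in> B m" "x = mode_form m v" using x by auto
      have "\<forall>v\<in>B m. f (mode_form m v) = 0"
        using B(2)[of m, unfolded vec.independent_explicit, THEN conjunct2, THEN spec, THEN mp,
            OF u0[OF mv(1), unfolded u_def]] .
      with mv show "f x = 0" by simp
    qed
  qed
  moreover have "card (?G ` ?S) = (\<Sum>m\<in>D. card (B m))"
    using fin finB by (simp add: card_image[OF inj] card_SigmaI)
  ultimately show ?thesis by (simp add: curl_mult_def B(4))
qed

theorem mainTheorem15:
  fixes L :: "(real^'n::{finite,linorder}) set" and lam :: real
  assumes "CARD('n) \<ge> 3" and "odd CARD('n)"
    and "is_lattice L"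
    and "lam \<noteq> 0"
  shows "(is_curl_eigenvalue L (complex_of_real lam) \<longleftrightarrow>
            (\<exists>m \<in> dual_lattice L. \<bar>lam\<bar> = 2 * pi * norm m))
       \<and> ((\<exists>m \<in> dual_lattice L. \<bar>lam\<bar> = 2 * pi * norm m) \<longrightarrow>
            real (curl_mult L (complex_of_real lam)) =
              1 / 2 * real ((CARD('n) - 1) choose ((CARD('n) - 1) div 2))
              * real (card {m \<in> dual_lattice L. norm m = \<bar>lam\<bar> / (2 * pi)}))"
proof -
  define D where "D = {m \<in> dual_lattice L. norm m = \<bar>lam\<bar> / (2 * pi)}"
  define C where "C = (CARD('n) - 1) choose ((CARD('n) - 1) div 2)"
  let ?d = "\<lambda>m. vec.dim (symbol_eigenspace m lam)"
  have D_iff: "m \<in> D \<longleftrightarrow> m \<in> dual_lattice L \<and> \<bar>lam\<bar> = 2 * pi * norm m" for m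
    by (auto simp: D_def field_simps)
  have pair: "?d m + ?d (- m) = C" if "m \<in> D" for m
    unfolding C_def using that assms by (intro dim_symbol_eigenspace_pair) (auto simp: D_iff)
  have neg: "- m \<in> D \<longleftrightarrow> m \<in> D" for m
    by (simp add: D_iff dual_lattice_def)
  have "uminus ` D = D" using neg by (metis (no_types) image_iff minus_minus subsetI subset_antisym)
  then have "(\<Sum>m\<in>D. ?d (- m)) = (\<Sum>m\<in>D. ?d m)"
    using sum.reindex[of uminus D ?d] by (simp add: o_def)
  then have "2 * (\<Sum>m\<in>D. ?d m) = (\<Sum>m\<in>D. ?d m + ?d (- m))" by (simp add: sum.distrib)
  also have "\<dots> = card D * C" using pair by simp
  finally have "2 * curl_mult L (complex_of_real lam) = card D * C"
    using curl_mult_eq_sum[OF assms(2,4,3)] by (simp add: D_def)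
  then have mult: "real (curl_mult L (complex_of_real lam)) = 1 / 2 * real C * real (card D)"
    by (simp add: field_simps flip: of_nat_mult)
  have "is_curl_eigenvalue L (complex_of_real lam) \<longleftrightarrow> D \<noteq> {}"
  proof
    assume "is_curl_eigenvalue L (complex_of_real lam)"
    then obtain w where w: "w \<in> curl_eigenspace L (complex_of_real lam)" "w \<noteq> 0"
      unfolding is_curl_eigenvalue_def by blast
    obtain bs where bs: "is_lattice_basis bs L" using lattice_basis_exists[OF assms(3)] by blast
    \<comment> \<open>Were \<open>D\<close> empty, the decomposition would be an empty sum and
      \<open>w\<close> would be zero.\<close>
    show "D \<noteq> {}"
      using curl_eigenform_decomposition[OF w(1) assms(2,4) bs, folded D_def] w(2) by auto
  next
    assume "D \<noteq> {}"
    then obtain m where m: "m \<in> D" by blast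
    have "C > 0" by (simp add: C_def)
    \<comment> \<open>Only the total dimension for \<open>m\<close> and \<open>- m\<close> is known.
      Its positivity yields an eigenvector at one of the two, and both lie in
      \<open>D\<close>.\<close>
    then have "?d m \<noteq> 0 \<or> ?d (- m) \<noteq> 0" using pair[OF m] by (metis add.right_neutral less_irrefl)
    then obtain l where l: "l \<in> D" "?d l \<noteq> 0" using m neg by blast
    then obtain v where v: "v \<in> symbol_eigenspace l lam" "v \<noteq> 0" by auto
    then obtain J where "v $ J \<noteq> 0" by (auto simp: vec_eq_iff)
    then have "mode_form l v \<noteq> 0"
      by (metis char_mode_nonzero mode_form_def mult_eq_0_iff zero_fun_apply)
    then show "is_curl_eigenvalue L (complex_of_real lam)"
      using mode_form_in_curl_eigenspace[OF _ v(1)] l(1) unfolding is_curl_eigenvalue_def D_iff by blast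
  qed
  moreover have "D \<noteq> {} \<longleftrightarrow> (\<exists>m \<in> dual_lattice L. \<bar>lam\<bar> = 2 * pi * norm m)"
    using D_iff by blast
  ultimately show ?thesis
    using mult unfolding C_def D_def by blast
qed

end
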